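(* Consider the sampling model on a finite connected graph $G=(V,E)$, $V=[n]$ (described in the context), and suppose that the signal structure $\{\mathbb{P}_i(\cdot\mid\theta)\}_{i\in V}$ satisfies the Bayes law and has finite information (both defined in the context). Then the common limiting posterior coincides with the posterior given all private signals: for every $i\in V$, $$\nu_i(\infty)=\mathrm{Law}(\theta\mid S_1,\dots,S_n)\quad\text{almost surely},$$ where $\nu_i(\infty)=\mathrm{Law}(\theta\mid\mathcal{H}_i(\infty))$ is the almost sure weak limit of $\nu_i(t)$ as $t\to\infty$.
   Context: Sampling model. Let $G=(V,E)$ be a finite undirected graph with $V=[n]=\{1,\dots,n\}$, and let $\partial i\subseteq V$ denote the set of neighbors of $i$. An unknown state $\theta\in\mathbb{R}^d$ is drawn from a prior $\nu$ (a Borel probability measure on $\mathbb{R}^d$). Each agent $i\in V$ obtains a private signal $S_i\in\mathbb{R}^d$ with $S_i\sim\mathbb{P}_i(\cdot\mid\theta)$, where $\mathbb{P}_i(\cdot\mid\theta)$ is a probability measure on $\mathbb{R}^d$ (a probability kernel in $\theta$); the signals $S_1,\dots,S_n$ are conditionally independent given $\theta$. The collection $\{\mathbb{P}_i(\cdot\mid\theta)\}_{i\in V}$ is called the signal structure. For $t=1,2,\dots$, the information of agent $i$ at time $t$ is the $\sigma$-algebra $\mathcal{H}_i(t):=\sigma\big(S_i,(Y_j(s))_{j\in\partial i,\,1\le s<t}\big)$ (so $\mathcal{H}_i(1)=\sigma(S_i)$), and its posterior is the random probability measure $\nu_i(t):=\mathrm{Law}(\theta\mid\mathcal{H}_i(t))$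 (regular conditional distribution). At time $t$, each agent $i$ samples $Y_i(t)\sim\nu_i(t)$ given $\mathcal{H}_i(t)$, conditionally independently of all other information; that is, conditionally on $\theta$, $(S_j)_{j\in V}$ and $(Y_j(s))_{j\in V,\,s<t}$, the variables $(Y_i(t))_{i\in V}$ are independent and $Y_i(t)$ has law $\nu_i(t)$. Agent $i$ then communicates $Y_i(t)$ to all its neighbors. Let $\mathcal{H}_i(\infty)$ be the $\sigma$-algebra generated by $\bigcup_{t\ge1}\mathcal{H}_i(t)$. Bayes law. The signal structure satisfies the Bayes law if there exists a deterministic function $f:(\mathbb{R}^d)^n\to\mathbb{R}_{>0}$ such that for every Borel measurable $A\subseteq\mathbb{R}^d$ with $\mathbb{P}(\theta\in A)\in(0,1)$, $$\mathbb{P}(\theta\in A\mid S_1,\dots,S_n)=\frac{\prod_{i=1}^n\mathbb{P}(\theta\in A\mid S_i)}{\mathbb{P}(\theta\in A)^{n-1}}\cdot f(S_1,\dots,S_n)\quad\text{almost surely}.$$ Finite information. $\mathbb{P}_i(\cdot\mid\theta)$ has finite information if for every Borel measurable $A\subseteq\mathbb{R}^d$ with $\mathbb{P}(\theta\in A)\in(0,1)$, $$\mathbb{E}\left|\log\left(\frac{\mathbb{P}(\theta\in A\mid S_i)}{\mathbb{P}(\theta\in A^c\mid S_i)}\right)\right|<\infty,$$ where the expectation is over the marginal distribution of $S_i$. The signal structure has finite information if $\mathbb{P}_i(\cdot\mid\theta)$ has finite information for every $i\in V$. *)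

theory Defs
  imports "HOL-Probability.Probability"
begin

section \<open>Conditional laws\<close>

text \<open>The \<open>\<sigma>\<close>-algebra on \<open>space M\<close> generated by a set of random variables.\<close>

definition sigma_of :: "'w measure \<Rightarrow> ('w \<Rightarrow> 'b::topological_space) set \<Rightarrow> 'w measure" where
  "sigma_of M \<X> = sigma (space M) {X -` A \<inter> space M | X A. X \<in> \<X> \<and> A \<in> sets borel}"

definition cond_prob_of :: "'w measure \<Rightarrow> 'w measure \<Rightarrow> 'w set \<Rightarrow> 'w \<Rightarrow> real" where
  "cond_prob_of M F B = real_cond_exp M F (indicat_real B)"

text \<open>\<open>K\<close> is a version of the regular conditional distribution of the \<open>N\<close>-valued
  random variable \<open>X\<close> given \<open>F\<close>. Such a version is unique up to null sets when the
  \<open>\<sigma>\<close>-algebra of \<open>N\<close> is countably generated.\<close>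

definition is_cond_law ::
  "'w measure \<Rightarrow> 'w measure \<Rightarrow> 'b measure \<Rightarrow> ('w \<Rightarrow> 'b) \<Rightarrow> ('w \<Rightarrow> 'b measure) \<Rightarrow> bool" where
  "is_cond_law M F N X K \<longleftrightarrow>
     K \<in> F \<rightarrow>\<^sub>M prob_algebra N \<and>
     (\<forall>A\<in>sets N. AE \<omega> in M. measure (K \<omega>) A = cond_prob_of M F (X -` A \<inter> space M) \<omega>)"

definition weak_limit :: "(nat \<Rightarrow> 'b::topological_space measure) \<Rightarrow> 'b measure \<Rightarrow> bool" where
  "weak_limit K L \<longleftrightarrow>
     (\<forall>f :: 'b \<Rightarrow> real. continuous_on UNIV f \<longrightarrow> bounded (range f) \<longrightarrow>
        (\<lambda>t. \<integral>x. f x \<partial>K t) \<longlonglongrightarrow> (\<integral>x. f x \<partial>L))"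


section \<open>The sampling model\<close>

text \<open>Undirected graphs are given by their adjacency relation, which contains both
  orientations of every edge.\<close>

definition simple_graph :: "'v set \<Rightarrow> 'v rel \<Rightarrow> bool" where
  "simple_graph V E \<longleftrightarrow> finite V \<and> E \<subseteq> V \<times> V \<and> sym E \<and> irrefl E"

definition connected_graph :: "'v set \<Rightarrow> 'v rel \<Rightarrow> bool" where
  "connected_graph V E \<longleftrightarrow> simple_graph V E \<and> (\<forall>i\<in>V. \<forall>j\<in>V. (i, j) \<in> E\<^sup>*)"

definition agent_info ::
  "'w measure \<Rightarrow> nat rel \<Rightarrow> (nat \<Rightarrow> 'w \<Rightarrow> 'b::topological_space) \<Rightarrow> (nat \<Rightarrow> nat \<Rightarrow> 'w \<Rightarrow> 'b)
     \<Rightarrow> nat \<Rightarrow> nat \<Rightarrow> 'w measure" where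
  "agent_info M E S Y i t =
     sigma_of M ({S i} \<union> {Y j s | j s. (i, j) \<in> E \<and> 1 \<le> s \<and> s < t})"

definition agent_info_limit ::
  "'w measure \<Rightarrow> nat rel \<Rightarrow> (nat \<Rightarrow> 'w \<Rightarrow> 'b::topological_space) \<Rightarrow> (nat \<Rightarrow> nat \<Rightarrow> 'w \<Rightarrow> 'b)
     \<Rightarrow> nat \<Rightarrow> 'w measure" where
  "agent_info_limit M E S Y i =
     sigma (space M) (\<Union>t\<in>{1..}. sets (agent_info M E S Y i t))"

definition global_history ::
  "'w measure \<Rightarrow> nat set \<Rightarrow> ('w \<Rightarrow> 'b::topological_space) \<Rightarrow> (nat \<Rightarrow> 'w \<Rightarrow> 'b)
     \<Rightarrow> (nat \<Rightarrow> nat \<Rightarrow> 'w \<Rightarrow> 'b) \<Rightarrow> nat \<Rightarrow> 'w measure" where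
  "global_history M V \<theta> S Y t =
     sigma_of M ({\<theta>} \<union> S ` V \<union> {Y j s | j s. j \<in> V \<and> 1 \<le> s \<and> s < t})"

text \<open>Conditional independence of the signals given the state, together with
  \<open>S i \<sim> P i (\<cdot> | \<theta>)\<close>, is expressed by saying that the conditional law of the whole
  signal vector given \<open>\<theta>\<close> is the product of the kernels; similarly for the samples drawn
  in one round given everything that precedes them. The posterior \<open>\<mu> i t\<close> is an arbitrary
  version of the conditional law of \<open>\<theta>\<close>. Time starts at \<open>1\<close>, so \<open>Y i 0\<close> and \<open>\<mu> i 0\<close> play
  no role.\<close>

locale sampling_model = prob_space M
  for n :: nat
    and E :: "nat rel"
    and \<nu> :: "(real ^ 'd) measure"
    and P :: "nat \<Rightarrow> real ^ 'd \<Rightarrow> (real ^ 'd) measure"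
    and M :: "'w measure"
    and \<theta> :: "'w \<Rightarrow> real ^ 'd"
    and S :: "nat \<Rightarrow> 'w \<Rightarrow> real ^ 'd"
    and Y :: "nat \<Rightarrow> nat \<Rightarrow> 'w \<Rightarrow> real ^ 'd"
    and \<mu> :: "nat \<Rightarrow> nat \<Rightarrow> 'w \<Rightarrow> (real ^ 'd) measure" +
  assumes graph: "simple_graph {1..n} E"
    and prior: "\<nu> \<in> space (prob_algebra borel)"
    and kernels: "\<And>i. i \<in> {1..n} \<Longrightarrow> P i \<in> borel \<rightarrow>\<^sub>M prob_algebra borel"
    and state_measurable: "\<theta> \<in> borel_measurable M"
    and signal_measurable: "\<And>i. i \<in> {1..n} \<Longrightarrow> S i \<in> borel_measurable M"
    and sample_measurable: "\<And>i t. i \<in> {1..n} \<Longrightarrow> 1 \<le> t \<Longrightarrow> Y i t \<in> borel_measurable M"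
    and state_law: "distr M borel \<theta> = \<nu>"
    and signal_law:
      "is_cond_law M (sigma_of M {\<theta>}) (\<Pi>\<^sub>M i\<in>{1..n}. borel)
         (\<lambda>\<omega>. \<lambda>i\<in>{1..n}. S i \<omega>) (\<lambda>\<omega>. \<Pi>\<^sub>M i\<in>{1..n}. P i (\<theta> \<omega>))"
    and posterior:
      "\<And>i t. i \<in> {1..n} \<Longrightarrow> 1 \<le> t \<Longrightarrow> is_cond_law M (agent_info M E S Y i t) borel \<theta> (\<mu> i t)"
    and sample_law:
      "\<And>t. 1 \<le> t \<Longrightarrow>
         is_cond_law M (global_history M {1..n} \<theta> S Y t) (\<Pi>\<^sub>M i\<in>{1..n}. borel)
           (\<lambda>\<omega>. \<lambda>i\<in>{1..n}. Y i t \<omega>) (\<lambda>\<omega>. \<Pi>\<^sub>M i\<in>{1..n}. \<mu> i t \<omega>)"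


section \<open>Conditions on the signal structure\<close>

definition bayes_law ::
  "'w measure \<Rightarrow> nat \<Rightarrow> ('w \<Rightarrow> 'b::topological_space) \<Rightarrow> (nat \<Rightarrow> 'w \<Rightarrow> 'b) \<Rightarrow> bool" where
  "bayes_law M n \<theta> S \<longleftrightarrow>
     (\<exists>f :: (nat \<Rightarrow> 'b) \<Rightarrow> real.
        (\<forall>x \<in> {1..n} \<rightarrow>\<^sub>E UNIV. 0 < f x) \<and>
        (\<forall>A \<in> sets borel. measure M (\<theta> -` A \<inter> space M) \<in> {0<..<1} \<longrightarrow>
           (AE \<omega> in M.
              cond_prob_of M (sigma_of M (S ` {1..n})) (\<theta> -` A \<inter> space M) \<omega> =
              (\<Prod>i\<in>{1..n}. cond_prob_of M (sigma_of M {S i}) (\<theta> -` A \<inter> space M) \<omega>)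
                / measure M (\<theta> -` A \<inter> space M) ^ (n - 1)
                * f (\<lambda>i\<in>{1..n}. S i \<omega>))))"

text \<open>The value of \<open>\<bar>log (p / q)\<bar>\<close> has to be infinite when one of the probabilities
  vanishes, whereas \<open>ln 0 = 0\<close> and \<open>p / 0 = 0\<close> for the total functions on the reals.\<close>

definition abs_log_ratio :: "real \<Rightarrow> real \<Rightarrow> ennreal" where
  "abs_log_ratio p q = (if 0 < p \<and> 0 < q then ennreal \<bar>ln (p / q)\<bar> else \<infinity>)"

definition finite_information ::
  "'w measure \<Rightarrow> ('w \<Rightarrow> 'b::topological_space) \<Rightarrow> ('w \<Rightarrow> 'b) \<Rightarrow> bool" where
  "finite_information M \<theta> X \<longleftrightarrow>
     (\<forall>A \<in> sets borel. measure M (\<theta> -` A \<inter> space M) \<in> {0<..<1} \<longrightarrow>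
        (\<integral>\<^sup>+ \<omega>. abs_log_ratio
           (cond_prob_of M (sigma_of M {X}) (\<theta> -` A \<inter> space M) \<omega>)
           (cond_prob_of M (sigma_of M {X}) (\<theta> -` (- A) \<inter> space M) \<omega>) \<partial>M) < \<infinity>)"

end

theory Submission
  imports Defs
begin

text \<open>
  Fix a Borel set \<open>A\<close> of states, let \<open>p\<^sub>i\<close> be the probability of \<open>\<theta> \<in> A\<close> given everything that
  agent \<open>i\<close> ever observes, and let \<open>q\<close> be its probability given all the signals. The main point is
  \<open>p\<^sub>i = q\<close> almost surely. Equality of the two random measures follows, since a countable family of
  open sets decides it; the same family reduces weak convergence to Levy's upward theorem
  (\<open>Levy_upward\<close>), applied to one set at a time.

  \<^emph>\<open>Agreement.\<close> Let \<open>j\<close> be a neighbour of \<open>i\<close>. Agent \<open>i\<close> sees the sample \<open>Y j t\<close>, whose law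
  given the past is the posterior of \<open>j\<close>. Write \<open>p\<^sub>i(t)\<close> for the posterior probability of \<open>A\<close> at time
  \<open>t\<close>. Then
  \<open>E[(1\<^sub>A - p\<^sub>i(t)) p\<^sub>j(t)] = E[(1\<^sub>A - p\<^sub>i(t)) 1\<^sub>A(Y j t)] = E[(p\<^sub>i - p\<^sub>i(t)) 1\<^sub>A(Y j t)]\<close>,
  where the first step conditions on the past and the second on the limiting information of \<open>i\<close>.
  By Levy's theorem the right-hand side tends to \<open>0\<close>, so that
  \<open>E[p\<^sub>i p\<^sub>j] = E[1\<^sub>A p\<^sub>j] = E[p\<^sub>j\<^sup>2]\<close>. Exchanging \<open>i\<close> and \<open>j\<close> gives
  \<open>E[(p\<^sub>i - p\<^sub>j)\<^sup>2] = 0\<close>. Connectedness spreads the agreement to all agents (\<open>connected_agree\<close>).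

  \<^emph>\<open>No extra information.\<close> The samples are produced from the signals by additional randomness that
  is independent of \<open>\<theta>\<close>, so conditioning on signals and samples together still gives \<open>q\<close>
  (\<open>comm_posterior_eq_signal_posterior\<close>). Hence \<open>p\<^sub>i = E[q | H\<^sub>i]\<close>, where \<open>H\<^sub>i\<close> is the limiting
  information of agent \<open>i\<close>.

  \<^emph>\<open>Identification.\<close> Under the Bayes law the log-odds of \<open>q\<close> are a sum of functions \<open>L\<^sub>i\<close> of the
  single signals, plus a constant (\<open>bayes_logit\<close>). Every term \<open>L\<^sub>i\<close> is known to agent \<open>i\<close>, and so is
  the common limit \<open>p\<close>; therefore \<open>q - p\<close> is orthogonal to \<open>L\<^sub>i\<close>, to their sum, and to the log-odds of
  \<open>p\<close>. Up to a truncation in \<open>p\<close> this says that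
  \<open>E[(q - p) (logit q - logit p)] = 0\<close>. The logit is strictly increasing,
  so the integrand is nonnegative and vanishes only where \<open>p = q\<close>
  (\<open>common_posterior_eq_full_posterior\<close>). Finite information makes the \<open>L\<^sub>i\<close> integrable.
\<close>

section \<open>Measures determined by a countable family of open sets\<close>

text \<open>An open set is the increasing union of finite unions of basic sets. These finite unions form a
countable family, which is what allows almost sure statements about random measures to be
collected into one null set.\<close>

lemma finite_union_of_basis_approximates_open:
  fixes L :: "'b::second_countable_topology measure" and \<B> :: "'b set set"
  assumes L: "finite_measure L" "sets L = sets borel"
    and \<B>: "countable \<B>" "topological_basis \<B>"
    and U: "open U" and e: "0 < e"
  obtains F where "finite F" "F \<subseteq> \<B>" "\<Union>F \<subseteq> U" "measure L U - e < measure L (\<Union>F)"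
proof (cases "U = {}")
  case True
  show ?thesis by (rule that[of "{}"]) (use True e in auto)
next
  case False
  interpret finite_measure L by fact
  obtain B' where B': "B' \<subseteq> \<B>" "\<Union>B' = U"
    using topological_basis_imp_subbasis \<B>(2) U by (metis topological_basis_def)
  with False have ne: "B' \<noteq> {}" by auto
  have cB: "countable B'" using B'(1) \<B>(1) countable_subset by blast
  define b where "b = from_nat_into B'"
  have rb: "range b = B'" unfolding b_def using ne cB by (rule range_from_nat_into)
  define W where "W k = (\<Union>(b ` {..k}))" for k
  have opn: "open (b k)" for k
    using rb B'(1) topological_basis_open[OF \<B>(2)] by blast
  have "(\<lambda>k. measure L (W k)) \<longlonglongrightarrow> measure L (\<Union>k. W k)"
  proof (rule finite_Lim_measure_incseq)
    show "range W \<subseteq> sets L" unfolding W_def L(2) using opn by auto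
    show "incseq W" unfolding W_def by (intro monoI UN_mono) auto
  qed
  moreover have "(\<Union>k. W k) = U"
    unfolding W_def using rb B'(2) by auto
  ultimately have "eventually (\<lambda>k. measure L U - e < measure L (W k)) sequentially"
    using e by (intro order_tendstoD) auto
  then obtain k where k: "measure L U - e < measure L (W k)"
    by (auto simp: eventually_sequentially)
  show ?thesis
    by (rule that[of "b ` {..k}"]) (use k rb B' in \<open>auto simp: W_def\<close>)
qed

lemma prob_measure_eqI_finite_unions_of_basis:
  fixes K L :: "'b::second_countable_topology measure" and \<B> :: "'b set set"
  assumes K: "prob_space K" "sets K = sets borel"
    and L: "prob_space L" "sets L = sets borel"
    and \<B>: "countable \<B>" "topological_basis \<B>"
    and eq: "\<And>F. finite F \<Longrightarrow> F \<subseteq> \<B> \<Longrightarrow> measure K (\<Union>F) = measure L (\<Union>F)"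
  shows "K = L"
proof -
  interpret K: prob_space K by fact
  interpret L: prob_space L by fact
  have le: "measure K1 U \<le> measure L1 U"
    if "finite_measure K1" "sets K1 = sets borel" "finite_measure L1" "sets L1 = sets borel"
      and eq1: "\<And>F. finite F \<Longrightarrow> F \<subseteq> \<B> \<Longrightarrow> measure K1 (\<Union>F) = measure L1 (\<Union>F)"
      and "open U" for K1 L1 :: "'b measure" and U
  proof (rule field_le_epsilon)
    fix e :: real assume "0 < e"
    from finite_union_of_basis_approximates_open[OF that(1,2) \<B> \<open>open U\<close> this]
    obtain F where F: "finite F" "F \<subseteq> \<B>" "\<Union>F \<subseteq> U" "measure K1 U - e < measure K1 (\<Union>F)" .
    have "measure L1 (\<Union>F) \<le> measure L1 U"
      using F(3) \<open>open U\<close> by (intro finite_measure.finite_measure_mono that(3)) (auto simp: that(4))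
    with F eq1[OF F(1,2)] show "measure K1 U \<le> measure L1 U + e" by simp
  qed
  have opn: "measure K U = measure L U" if "open U" for U
    using le[of K L U] le[of L K U] that eq K L K.finite_measure_axioms L.finite_measure_axioms
    by (simp add: order_antisym)
  show ?thesis
  proof (rule measure_eqI_generator_eq[where E = "{U. open U}" and \<Omega> = UNIV and A = "\<lambda>_. UNIV"])
    show "Int_stable {U. open U}" by (auto simp: Int_stable_def)
    show "sets K = sigma_sets UNIV {U. open U}" "sets L = sigma_sets UNIV {U. open U}"
      by (simp_all add: K L borel_def)
  qed (use opn in \<open>auto simp: K.emeasure_eq_measure L.emeasure_eq_measure\<close>)
qed

text \<open>The layer sum that underlies the portmanteau argument.\<close>

text \<open>A number in the unit interval, discretised from below with mesh \<open>1/k\<close> by counting the levels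
strictly below it. Applied to the values of a function, the levels turn into the open sets
\<open>{x. j/k < g x}\<close>, which links integrals of continuous functions to measures of open sets.\<close>

lemma layer_sum_bounds:
  fixes y :: real and k :: nat
  assumes y: "0 \<le> y" "y \<le> 1" and k: "0 < k"
  defines "s \<equiv> (\<Sum>j\<in>{1..k}. of_bool (real j / real k < y)) / real k"
  shows "s \<le> y" "y \<le> s + 1 / real k"
proof -
  define m where "m = nat \<lceil>real k * y\<rceil>"
  have ky: "0 \<le> real k * y" "real k * y \<le> real k" using y k by (auto simp: mult_left_le)
  have "{j \<in> {1..k}. real j / real k < y} = {1..<m}"
  proof (rule set_eqI)
    fix j
    have "real j / real k < y \<longleftrightarrow> real j < real k * y" using k by (simp add: field_simps)
    also have "\<dots> \<longleftrightarrow> j < m" unfolding m_def using ky by linarith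
    finally have *: "real j / real k < y \<longleftrightarrow> j < m" .
    have "m \<le> k" unfolding m_def using ky by linarith
    with * show "j \<in> {j \<in> {1..k}. real j / real k < y} \<longleftrightarrow> j \<in> {1..<m}" by auto
  qed
  moreover have "(\<Sum>j\<in>{1..k}. of_bool (real j / real k < y)) = real (card {j \<in> {1..k}. real j / real k < y})"
    by (simp add: of_bool_def sum.If_cases Int_def)
  ultimately have s: "s = real (m - 1) / real k" by (simp add: s_def)
  have "real (m - 1) \<le> real k * y" "real k * y \<le> real (m - 1) + 1"
    unfolding m_def using ky by linarith+
  then show "s \<le> y" "y \<le> s + 1 / real k"
    unfolding s using k by (auto simp: field_simps)
qed

text \<open>The portmanteau argument. Convergence on finite unions of basic sets bounds the measures of every open
set asymptotically from below; summing over layers gives the same for the integral of a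
continuous \<open>g\<close> with values in the unit interval. The matching upper bound is the lower bound for
\<open>1 - g\<close>, and every bounded continuous function is an affine image of such a \<open>g\<close>.\<close>

lemma weak_limit_finite_unions_of_basis:
  fixes K :: "nat \<Rightarrow> 'b::second_countable_topology measure" and \<B> :: "'b set set"
  assumes K: "\<And>t. prob_space (K t)" "\<And>t. sets (K t) = sets borel"
    and L: "prob_space L" "sets L = sets borel"
    and \<B>: "countable \<B>" "topological_basis \<B>"
    and lim: "\<And>F. finite F \<Longrightarrow> F \<subseteq> \<B> \<Longrightarrow> (\<lambda>t. measure (K t) (\<Union>F)) \<longlonglongrightarrow> measure L (\<Union>F)"
  shows "weak_limit K L"
proof -
  interpret L: prob_space L by fact
  have opn: "eventually (\<lambda>t. measure L U - e < measure (K t) U) sequentially"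
    if "open U" "0 < e" for U e
  proof -
    from finite_union_of_basis_approximates_open[OF L.finite_measure_axioms L(2) \<B> that]
    obtain F where F: "finite F" "F \<subseteq> \<B>" "\<Union>F \<subseteq> U" "measure L U - e < measure L (\<Union>F)" .
    have "eventually (\<lambda>t. measure L U - e < measure (K t) (\<Union>F)) sequentially"
      using lim[OF F(1,2)] F(4) by (rule order_tendstoD)
    moreover have "measure (K t) (\<Union>F) \<le> measure (K t) U" for t
      using F(3) that(1) K by (intro finite_measure.finite_measure_mono)
        (auto simp: prob_space.finite_measure)
    ultimately show ?thesis by (auto elim!: eventually_mono intro: less_le_trans)
  qed
  have int: "integrable N g" if "prob_space N" "sets N = sets borel" "continuous_on UNIV g" "\<And>x. \<bar>g x\<bar> \<le> b"
    for N and g :: "'b \<Rightarrow> real" and b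
  proof -
    interpret N: prob_space N by fact
    have "g \<in> borel_measurable N"
      using borel_measurable_continuous_onI[OF that(3)] that(2) by (simp cong: measurable_cong_sets)
    then show ?thesis using that(4) by (intro N.integrable_const_bound[of _ b]) auto
  qed
  have lower: "eventually (\<lambda>t. (\<integral>x. g x \<partial>L) - e < (\<integral>x. g x \<partial>K t)) sequentially"
    if g: "continuous_on UNIV g" "\<And>x. 0 \<le> g x" "\<And>x. g x \<le> 1" and e: "0 < e"
    for g :: "'b \<Rightarrow> real" and e
  proof -
    obtain k :: nat where k: "0 < k" "1 / real k < e / 2"
      using e by (metis half_gt_zero nat_approx_posE zero_less_Suc)
    define U where "U j = {x. real j / real k < g x}" for j
    define s where "s x = (\<Sum>j\<in>{1..k}. indicator (U j) x) / real k" for x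
    have U: "open (U j)" for j
      unfolding U_def using g(1) by (intro open_Collect_less) auto
    have s: "s x \<le> g x" "g x \<le> s x + 1 / real k" for x
      using layer_sum_bounds[OF g(2,3) k(1), of x]
      by (auto simp: s_def U_def indicator_def of_bool_def)
    have sint: "integrable N s" "(\<integral>x. s x \<partial>N) = (\<Sum>j\<in>{1..k}. measure N (U j)) / real k"
      if "prob_space N" "sets N = sets borel" for N
    proof -
      interpret N: prob_space N by fact
      have m: "U j \<in> sets N" for j using U that by auto
      show "integrable N s" unfolding s_def using m by (auto simp: N.emeasure_eq_measure)
      show "(\<integral>x. s x \<partial>N) = (\<Sum>j\<in>{1..k}. measure N (U j)) / real k"
        unfolding s_def using m sets.sets_into_space[OF m]
        by (subst integral_divide_zero, subst Bochner_Integration.integral_sum)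
          (auto simp: N.emeasure_eq_measure Int_absorb2)
    qed
    have "eventually (\<lambda>t. \<forall>j\<in>{1..k}. measure L (U j) - e / 2 < measure (K t) (U j)) sequentially"
      using opn[OF U] e by (intro eventually_ball_finite) auto
    then show ?thesis
    proof eventually_elim
      case (elim t)
      have "(\<integral>x. g x \<partial>L) \<le> (\<integral>x. s x + 1 / real k \<partial>L)"
      proof (rule integral_mono)
        show "integrable L g" using g by (intro int[OF L, of _ 1]) auto
      qed (use s sint(1)[OF L] in auto)
      also have "\<dots> = (\<Sum>j\<in>{1..k}. measure L (U j)) / real k + 1 / real k"
        using sint[OF L] by (simp add: L.prob_space)
      also have "\<dots> \<le> (\<Sum>j\<in>{1..k}. measure (K t) (U j) + e / 2) / real k + 1 / real k"
        using elim k by (intro add_right_mono divide_right_mono sum_mono) (auto intro: less_imp_le simp: algebra_simps)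
      also have "\<dots> = (\<integral>x. s x \<partial>K t) + e / 2 + 1 / real k"
        using sint(2)[OF K] k by (simp add: sum.distrib add_divide_distrib)
      also have "(\<integral>x. s x \<partial>K t) \<le> (\<integral>x. g x \<partial>K t)"
      proof (rule integral_mono)
        show "integrable (K t) g" using g by (intro int[OF K, of _ 1]) auto
      qed (use s sint(1)[OF K] in auto)
      finally show ?case using k(2) by simp
    qed
  qed
  show ?thesis unfolding weak_limit_def
  proof (intro allI impI)
    fix f :: "'b \<Rightarrow> real" assume f: "continuous_on UNIV f" "bounded (range f)"
    obtain b where b: "0 < b" "\<And>x. \<bar>f x\<bar> \<le> b"
      using f(2) unfolding bounded_pos by auto
    \<comment> \<open>The affine rescaling that maps the range of \<open>f\<close> into the unit interval.\<close>
    define g where "g x = (f x + b) / (2 * b)" for x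
    have b': "- b \<le> f x" "f x \<le> b" for x using b(2)[of x] by (auto simp: abs_le_iff)
    have g01: "0 \<le> g x" "g x \<le> 1" for x
      using b'[of x] b(1) by (auto simp: g_def divide_le_eq)
    have gc: "continuous_on UNIV g" "continuous_on UNIV (\<lambda>x. 1 - g x)"
      unfolding g_def using b f(1) by (auto intro!: continuous_intros)
    have gi: "integrable N g" if "prob_space N" "sets N = sets borel" for N
      using int[OF that gc(1), of 1] g01 by auto
    have g1: "(\<integral>x. 1 - g x \<partial>N) = 1 - (\<integral>x. g x \<partial>N)" if "prob_space N" "sets N = sets borel" for N
      using gi[OF that] that(1) by (simp add: prob_space.prob_space finite_measure.integrable_const prob_space.finite_measure)
    have "(\<lambda>t. \<integral>x. g x \<partial>K t) \<longlonglongrightarrow> (\<integral>x. g x \<partial>L)"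
    proof (rule tendstoI)
      fix e :: real assume e: "0 < e"
      have "eventually (\<lambda>t. (\<integral>x. 1 - g x \<partial>L) - e < (\<integral>x. 1 - g x \<partial>K t)) sequentially"
        using g01 by (intro lower[OF gc(2) _ _ e]) auto
      with lower[OF gc(1) g01 e]
      show "eventually (\<lambda>t. dist (\<integral>x. g x \<partial>K t) (\<integral>x. g x \<partial>L) < e) sequentially"
        by eventually_elim (auto simp: g1[OF K] g1[OF L] dist_real_def)
    qed
    then have "(\<lambda>t. 2 * b * (\<integral>x. g x \<partial>K t) - b) \<longlonglongrightarrow> 2 * b * (\<integral>x. g x \<partial>L) - b"
      by (intro tendsto_intros)
    moreover have "2 * b * (\<integral>x. g x \<partial>N) - b = (\<integral>x. f x \<partial>N)" if "prob_space N" "sets N = sets borel" for N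
    proof -
      interpret N: prob_space N by fact
      have "(\<integral>x. f x \<partial>N) = (\<integral>x. 2 * b * g x - b \<partial>N)"
        using b(1) by (intro Bochner_Integration.integral_cong) (auto simp: g_def)
      also have "\<dots> = 2 * b * (\<integral>x. g x \<partial>N) - b" using gi[OF that] by (simp add: N.prob_space)
      finally show ?thesis by simp
    qed
    ultimately show "(\<lambda>t. \<integral>x. f x \<partial>K t) \<longlonglongrightarrow> (\<integral>x. f x \<partial>L)"
      using K L by simp
  qed
qed

section \<open>Levy's upward theorem\<close>

lemma sigma_finite_subalgebra_prob:
  "prob_space M \<Longrightarrow> subalgebra M F \<Longrightarrow> sigma_finite_subalgebra M F"
  by (intro finite_measure_subalgebra_is_sigma_finite)
    (simp add: finite_measure_subalgebra_def finite_measure_subalgebra_axioms_def prob_space.finite_measure)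

text \<open>Split the event according to the first time at which the level \<open>c\<close> is exceeded. That time
being \<open>t\<close> is an event of \<open>F t\<close>, on which \<open>W\<close> has the same integral as its conditional
expectation, hence at least \<open>c\<close> times the probability.\<close>

lemma (in prob_space) cond_exp_maximal_inequality:
  fixes F :: "nat \<Rightarrow> 'a measure"
  assumes sub: "\<And>t. subalgebra M (F t)"
    and mono: "\<And>s t. s \<le> t \<Longrightarrow> sets (F s) \<subseteq> sets (F t)"
    and W: "integrable M W" "\<And>x. 0 \<le> W x" and c: "0 < c"
  shows "prob {x \<in> space M. \<exists>t. c < real_cond_exp M (F t) W x} \<le> expectation W / c"
proof -
  note sfs = sigma_finite_subalgebra_prob[OF prob_space_axioms sub]
  have sp: "space (F t) = space M" for t using sub by (auto simp: subalgebra_def)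
  have setsF: "D \<in> sets (F t) \<Longrightarrow> D \<in> sets M" for D t using sub by (auto simp: subalgebra_def)
  define A where "A t = {x \<in> space M. c < real_cond_exp M (F t) W x}" for t
  have A: "A t \<in> sets (F t)" for t
    unfolding A_def sp[symmetric, of t] by measurable
  define B where "B = disjointed A"
  have B: "B t \<in> sets (F t)" for t
    unfolding B_def disjointed_def using A mono less_imp_le by (intro sets.Diff sets.finite_UN) (auto, blast)
  have BM: "range B \<subseteq> sets M" using B setsF by auto
  have "c * prob (B t) \<le> (\<integral>x\<in>B t. W x \<partial>M)" for t
  proof -
    have "c * prob (B t) = (\<integral>x\<in>B t. c \<partial>M)"
      using BM by (simp add: set_lebesgue_integral_def mult.commute)
    also have "\<dots> \<le> (\<integral>x\<in>B t. real_cond_exp M (F t) W x \<partial>M)"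
      unfolding set_lebesgue_integral_def
    proof (rule integral_mono)
      show "integrable M (\<lambda>x. indicator (B t) x *\<^sub>R c)"
        using BM by (auto intro!: integrable_real_indicator simp: emeasure_eq_measure)
      show "integrable M (\<lambda>x. indicator (B t) x *\<^sub>R real_cond_exp M (F t) W x)"
        using BM sigma_finite_subalgebra.real_cond_exp_int(1)[OF sfs W(1)]
        by (intro integrable_mult_indicator) auto
      show "indicator (B t) x *\<^sub>R c \<le> indicator (B t) x *\<^sub>R real_cond_exp M (F t) W x" for x
        using disjointed_subset[of A t] by (auto simp: B_def A_def indicator_def)
    qed
    also have "\<dots> = (\<integral>x\<in>B t. W x \<partial>M)"
      using sigma_finite_subalgebra.real_cond_exp_intA[OF sfs W(1) B] by simp
    finally show ?thesis .
  qed
  then have le: "prob (B t) \<le> (\<integral>x\<in>B t. W x \<partial>M) / c" for t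
    using c by (simp add: field_simps)
  have sums: "(\<lambda>t. prob (B t)) sums prob (\<Union>t. B t)"
    using BM disjoint_family_disjointed[of A] unfolding B_def by (intro finite_measure_UNION)
  have "prob (\<Union>t. B t) \<le> expectation W / c"
  proof (rule LIMSEQ_le_const2[OF sums[unfolded sums_def]], intro exI allI impI)
    fix k
    have int: "integrable M (\<lambda>x. indicator (B t) x *\<^sub>R W x)" for t
      using W BM by (intro integrable_mult_indicator) auto
    have "(\<Sum>t<k. prob (B t)) \<le> (\<Sum>t<k. (\<integral>x\<in>B t. W x \<partial>M) / c)"
      by (intro sum_mono le)
    also have "\<dots> = expectation (\<lambda>x. \<Sum>t<k. indicator (B t) x *\<^sub>R W x) / c"
      using int by (subst Bochner_Integration.integral_sum)
        (simp_all only: set_lebesgue_integral_def sum_divide_distrib)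
    also have "\<dots> \<le> expectation W / c"
    proof (intro divide_right_mono integral_mono)
      fix x
      have *: "(\<lambda>j. indicat_real (B j) x) sums indicator (\<Union>i. B i) x"
        unfolding B_def by (rule indicator_sums) (use disjoint_family_disjointed[of A] in
          \<open>auto simp: disjoint_family_on_def\<close>)
      have "(\<Sum>j<k. indicat_real (B j) x) \<le> indicator (\<Union>i. B i) x"
        unfolding sums_unique[OF *] by (rule sum_le_suminf[OF sums_summable[OF *]]) auto
      also have "\<dots> \<le> 1" by (rule indicator_le_1)
      finally show "(\<Sum>t<k. indicator (B t) x *\<^sub>R W x) \<le> W x"
        using W(2)[of x] by (simp add: sum_distrib_right[symmetric] mult_left_le_one_le sum_nonneg)
      show "integrable M (\<lambda>x. \<Sum>t<k. indicator (B t) x *\<^sub>R W x)"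
        using int by (rule Bochner_Integration.integrable_sum)
    qed (use c W in auto)
    finally show "(\<Sum>t<k. prob (B t)) \<le> expectation W / c" .
  qed
  also have "(\<Union>t. B t) = {x \<in> space M. \<exists>t. c < real_cond_exp M (F t) W x}"
    unfolding B_def UN_disjointed_eq by (auto simp: A_def)
  finally show ?thesis .
qed

text \<open>The functions with such approximations form a vector space that is closed under dominated
pointwise limits. It contains the indicators of the intersection-stable family \<open>\<Union>t. sets (F t)\<close>,
hence by a Dynkin argument those of all events of \<open>G\<close>, and therefore all integrable \<open>G\<close>-measurable
functions.\<close>

lemma (in prob_space) L1_approximation_by_filtration:
  fixes F :: "nat \<Rightarrow> 'a measure" and g :: "'a \<Rightarrow> real"
  defines "G \<equiv> sigma (space M) (\<Union>t. sets (F t))"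
  assumes sub: "\<And>t. subalgebra M (F t)"
    and mono: "\<And>s t. s \<le> t \<Longrightarrow> sets (F s) \<subseteq> sets (F t)"
    and g: "integrable M g" "g \<in> borel_measurable G" and e: "0 < e"
  obtains s Z where "Z \<in> borel_measurable (F s)" "integrable M Z"
    "expectation (\<lambda>x. \<bar>g x - Z x\<bar>) < e"
proof -
  have sp: "space (F t) = space M" for t using sub by (auto simp: subalgebra_def)
  have setsF: "D \<in> sets (F t) \<Longrightarrow> D \<in> sets M" for D t using sub by (auto simp: subalgebra_def)
  have gen: "(\<Union>t. sets (F t)) \<subseteq> Pow (space M)"
    using setsF sets.sets_into_space by blast
  have setsG: "sets G = sigma_sets (space M) (\<Union>t. sets (F t))"
    unfolding G_def using gen by simp
  have subG: "subalgebra M G"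
    using setsF sets.sigma_sets_subset[of "\<Union>t. sets (F t)" M]
    by (auto simp: subalgebra_def setsG) (auto simp: G_def space_measure_of_conv)
  define P :: "('a \<Rightarrow> real) \<Rightarrow> bool" where
    "P g \<longleftrightarrow> integrable M g \<and> (\<forall>e>0. \<exists>s Z. Z \<in> borel_measurable (F s) \<and> integrable M Z \<and>
       expectation (\<lambda>x. \<bar>g x - Z x\<bar>) < e)" for g
  have P_int: "integrable M g" if "P g" for g using that by (simp add: P_def)
  have P_D: "\<exists>s Z. Z \<in> borel_measurable (F s) \<and> integrable M Z \<and> expectation (\<lambda>x. \<bar>g x - Z x\<bar>) < e"
    if "P g" "0 < e" for g e using that unfolding P_def by blast
  have P_F: "P Z" if "Z \<in> borel_measurable (F s)" "integrable M Z" for Z s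
    unfolding P_def using that by (auto intro!: exI[of _ s] exI[of _ Z])
  have P_0: "P (\<lambda>_. 0)" by (rule P_F[of _ 0]) auto
  have P_add: "P (\<lambda>x. f x + g x)" if fg: "P f" "P g" for f g
    unfolding P_def
  proof (intro conjI allI impI)
    fix e :: real assume "0 < e"
    then have e2: "0 < e / 2" by simp
    obtain s Z where Z: "Z \<in> borel_measurable (F s)" "integrable M Z"
        "expectation (\<lambda>x. \<bar>f x - Z x\<bar>) < e / 2" "integrable M f"
      using P_D[OF fg(1) e2] P_int[OF fg(1)] by blast
    obtain s' Z' where Z': "Z' \<in> borel_measurable (F s')" "integrable M Z'"
        "expectation (\<lambda>x. \<bar>g x - Z' x\<bar>) < e / 2" "integrable M g"
      using P_D[OF fg(2) e2] P_int[OF fg(2)] by blast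
    have "subalgebra (F (max s s')) (F s)" "subalgebra (F (max s s')) (F s')"
      using mono by (auto simp: subalgebra_def sp)
    then have "(\<lambda>x. Z x + Z' x) \<in> borel_measurable (F (max s s'))"
      by (intro borel_measurable_add measurable_from_subalg[OF _ Z(1)] measurable_from_subalg[OF _ Z'(1)])
    moreover have "expectation (\<lambda>x. \<bar>f x + g x - (Z x + Z' x)\<bar>)
        \<le> expectation (\<lambda>x. \<bar>f x - Z x\<bar> + \<bar>g x - Z' x\<bar>)"
      using Z Z' by (intro integral_mono) auto
    moreover have "\<dots> < e" using Z Z' by simp
    ultimately show "\<exists>s Z. Z \<in> borel_measurable (F s) \<and> integrable M Z \<and>
        expectation (\<lambda>x. \<bar>f x + g x - Z x\<bar>) < e"
      using Z(2) Z'(2) by (intro exI[of _ "max s s'"] exI[of _ "\<lambda>x. Z x + Z' x"]) auto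
  qed (intro Bochner_Integration.integrable_add P_int fg)
  have P_cmult: "P (\<lambda>x. c * f x)" if f: "P f" for f and c :: real
  proof (cases "c = 0")
    case True
    with P_0 show ?thesis by simp
  next
    case False
    show ?thesis unfolding P_def
    proof (intro conjI allI impI)
      fix e :: real assume "0 < e"
      with False have e': "0 < e / \<bar>c\<bar>" by simp
      obtain s Z where Z: "Z \<in> borel_measurable (F s)" "integrable M Z"
          "expectation (\<lambda>x. \<bar>f x - Z x\<bar>) < e / \<bar>c\<bar>" "integrable M f"
        using P_D[OF f e'] P_int[OF f] by blast
      have "expectation (\<lambda>x. \<bar>c * f x - c * Z x\<bar>) = \<bar>c\<bar> * expectation (\<lambda>x. \<bar>f x - Z x\<bar>)"
        by (simp add: right_diff_distrib[symmetric] abs_mult)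
      also have "\<dots> < e" using Z False by (simp add: field_simps)
      finally show "\<exists>s Z. Z \<in> borel_measurable (F s) \<and> integrable M Z \<and>
          expectation (\<lambda>x. \<bar>c * f x - Z x\<bar>) < e"
        using Z by (intro exI[of _ s] exI[of _ "\<lambda>x. c * Z x"]) auto
    qed (intro integrable_mult_right P_int f)
  qed
  \<comment> \<open>Dominated convergence turns pointwise into \<open>L\<^sup>1\<close> convergence.\<close>
  have P_lim: "P f" if u: "\<And>i. P (u i)" and w: "integrable M w" and f: "f \<in> borel_measurable M"
    and lim: "\<And>x. x \<in> space M \<Longrightarrow> (\<lambda>i. u i x) \<longlonglongrightarrow> f x"
    and bnd: "\<And>i x. x \<in> space M \<Longrightarrow> \<bar>u i x\<bar> \<le> w x" for u :: "nat \<Rightarrow> 'a \<Rightarrow> real" and f w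
  proof -
    have ui: "integrable M (u i)" for i using u by (simp add: P_def)
    have fw: "\<bar>f x\<bar> \<le> w x" if "x \<in> space M" for x
      using LIMSEQ_le_const2[OF tendsto_rabs[OF lim[OF that]]] bnd[OF that] by blast
    have fi: "integrable M f"
      using fw by (intro Bochner_Integration.integrable_bound[OF w f]) fastforce
    have "(\<lambda>i. expectation (\<lambda>x. \<bar>f x - u i x\<bar>)) \<longlonglongrightarrow> expectation (\<lambda>x. 0)"
    proof (rule integral_dominated_convergence[where w = "\<lambda>x. 2 * w x"])
      show "AE x in M. (\<lambda>i. \<bar>f x - u i x\<bar>) \<longlonglongrightarrow> 0"
      proof (rule AE_I2)
        fix x assume "x \<in> space M"
        from tendsto_rabs[OF tendsto_diff[OF tendsto_const[of "f x"] lim[OF this]]]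
        show "(\<lambda>i. \<bar>f x - u i x\<bar>) \<longlonglongrightarrow> 0" by simp
      qed
      show "AE x in M. norm \<bar>f x - u i x\<bar> \<le> 2 * w x" for i
        using fw bnd[of _ i] by (intro AE_I2) (smt (verit) real_norm_def)
    qed (use w f ui in auto)
    then have conv: "(\<lambda>i. expectation (\<lambda>x. \<bar>f x - u i x\<bar>)) \<longlonglongrightarrow> 0" by simp
    show ?thesis unfolding P_def
    proof (intro conjI allI impI)
      fix e :: real assume "0 < e"
      then have e2: "0 < e / 2" by simp
      from order_tendstoD(2)[OF conv e2] obtain i where i: "expectation (\<lambda>x. \<bar>f x - u i x\<bar>) < e / 2"
        by (auto simp: eventually_sequentially)
      obtain s Z where Z: "Z \<in> borel_measurable (F s)" "integrable M Z"
          "expectation (\<lambda>x. \<bar>u i x - Z x\<bar>) < e / 2"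
        using P_D[OF u[of i] e2] by blast
      have "expectation (\<lambda>x. \<bar>f x - Z x\<bar>) \<le> expectation (\<lambda>x. \<bar>f x - u i x\<bar> + \<bar>u i x - Z x\<bar>)"
        using Z fi ui by (intro integral_mono) auto
      also have "\<dots> < e" using Z fi ui i by simp
      finally show "\<exists>s Z. Z \<in> borel_measurable (F s) \<and> integrable M Z \<and>
          expectation (\<lambda>x. \<bar>f x - Z x\<bar>) < e" using Z by auto
    qed (rule fi)
  qed
  have stable: "Int_stable (\<Union>t. sets (F t))"
  proof (rule Int_stableI)
    fix a b assume "a \<in> (\<Union>t. sets (F t))" "b \<in> (\<Union>t. sets (F t))"
    then obtain s t where "a \<in> sets (F s)" "b \<in> sets (F t)" by auto
    then have "a \<in> sets (F (max s t))" "b \<in> sets (F (max s t))"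
      using mono[of s "max s t"] mono[of t "max s t"] by auto
    then show "a \<inter> b \<in> (\<Union>t. sets (F t))" by auto
  qed
  have P_ind: "P (indicator A)" if "A \<in> sigma_sets (space M) (\<Union>t. sets (F t))" for A
    using stable gen that
  proof (induction rule: sigma_sets_induct_disjoint)
    case (basic A)
    then obtain t where t: "A \<in> sets (F t)" by auto
    show ?case
      using t setsF by (intro P_F[of _ t]) (auto simp: emeasure_eq_measure)
  next
    case empty
    show ?case using P_0 by (simp add: indicator_def[abs_def])
  next
    case (compl A)
    have "space M \<in> sets (F 0)" using sets.top[of "F 0"] by (simp add: sp)
    then have "P (indicator (space M))" by (intro P_F[of _ 0]) (auto simp: emeasure_eq_measure)
    then have "P (\<lambda>x. indicator (space M) x + (-1) * indicator A x)"
      by (intro P_add P_cmult compl)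
    moreover have "A \<subseteq> space M"
      using compl(1) sigma_sets_into_sp[OF gen] by blast
    then have "(\<lambda>x. indicator (space M) x + (-1) * indicator A x) = (indicator (space M - A) :: 'a \<Rightarrow> real)"
      by (auto simp: indicator_def fun_eq_iff)
    ultimately show ?case by simp
  next
    case (union A)
    have P_sum: "P (\<lambda>x. \<Sum>j<i. indicator (A j) x)" for i
    proof (induction i)
      case 0
      show ?case using P_0 by simp
    next
      case (Suc i)
      then show ?case using P_add[OF Suc union(3)[of i]] by (simp add: add.commute)
    qed
    have AM: "A j \<in> sets M" for j
      using union(2) subG by (auto simp: subalgebra_def setsG)
    show ?case
    proof (rule P_lim[of _ "\<lambda>_. 1", OF P_sum])
      fix x
      have *: "(\<lambda>j. indicat_real (A j) x) sums indicator (\<Union>i. A i) x"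
        by (rule indicator_sums) (use union(1) in \<open>auto simp: disjoint_family_on_def\<close>)
      then show "(\<lambda>i. \<Sum>j<i. indicat_real (A j) x) \<longlonglongrightarrow> indicator (\<Union>i. A i) x"
        by (simp add: sums_def)
      have "(\<Sum>j<i. indicat_real (A j) x) \<le> indicator (\<Union>i. A i) x" for i
        unfolding sums_unique[OF *] by (rule sum_le_suminf[OF sums_summable[OF *]]) auto
      also have "indicat_real (\<Union>i. A i) x \<le> 1" by (rule indicator_le_1)
      finally show "\<bar>\<Sum>j<i. indicat_real (A j) x\<bar> \<le> 1" for i
        by (simp only: abs_of_nonneg[OF sum_nonneg[OF indicator_pos_le]])
    qed (use AM in auto)
  qed
  have "integrable (restr_to_subalg M G) g"
    by (rule integrable_in_subalg[OF subG g(2,1)])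
  then have "P g"
  proof (induction rule: integrable_induct)
    case (base A c)
    then have "A \<in> sigma_sets (space M) (\<Union>t. sets (F t))"
      by (simp add: sets_restr_to_subalg[OF subG] setsG)
    from P_cmult[OF P_ind[OF this], of c] show ?case by (simp add: mult.commute)
  next
    case (add f g)
    show ?case by (rule P_add[OF add.IH])
  next
    case (lim f s)
    have fi: "integrable M f" by (rule integrable_from_subalg[OF subG]) (rule lim)
    show ?case
    proof (rule P_lim[of s "\<lambda>x. 2 * \<bar>f x\<bar>"])
      show "P (s i)" for i by (rule lim.IH)
      fix x assume "x \<in> space M"
      then have x: "x \<in> space (restr_to_subalg M G)" by (simp add: space_restr_to_subalg)
      show "(\<lambda>i. s i x) \<longlonglongrightarrow> f x" using x by (rule lim.hyps)
      have "norm (s i x) \<le> 2 * norm (f x)" for i using x by (rule lim.hyps)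
      then show "\<bar>s i x\<bar> \<le> 2 * \<bar>f x\<bar>" for i by simp
    qed (use fi in simp_all)
  qed
  from P_D[OF this e] that show ?thesis by blast
qed

text \<open>The limit \<open>g\<close> is \<open>L\<^sup>1\<close>-close to some \<open>Z\<close> measurable with respect to a single \<open>F s\<close>. From time
\<open>s\<close> on, the error at time \<open>t\<close> is at most \<open>E[W | F t] + W\<close> with \<open>W = \<bar>g - Z\<bar>\<close>, because
conditioning fixes \<open>Z\<close>. The maximal inequality controls the first term simultaneously for all \<open>t\<close>,
Markov's inequality controls the second, and both bounds are proportional to the \<open>L\<^sup>1\<close>-distance,
which is arbitrary.\<close>

theorem (in prob_space) Levy_upward:
  fixes F :: "nat \<Rightarrow> 'a measure" and X :: "'a \<Rightarrow> real"
  defines "G \<equiv> sigma (space M) (\<Union>t. sets (F t))"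
  assumes sub: "\<And>t. subalgebra M (F t)"
    and mono: "\<And>s t. s \<le> t \<Longrightarrow> sets (F s) \<subseteq> sets (F t)"
    and X: "integrable M X"
  shows "AE x in M. (\<lambda>t. real_cond_exp M (F t) X x) \<longlonglongrightarrow> real_cond_exp M G X x"
proof -
  have sp: "space (F t) = space M" for t using sub by (auto simp: subalgebra_def)
  have setsF: "D \<in> sets (F t) \<Longrightarrow> D \<in> sets M" for D t using sub by (auto simp: subalgebra_def)
  have gen: "(\<Union>t. sets (F t)) \<subseteq> Pow (space M)"
    using setsF sets.sets_into_space by blast
  have setsG: "sets G = sigma_sets (space M) (\<Union>t. sets (F t))"
    unfolding G_def using gen by simp
  have subG: "subalgebra M G"
    using setsF sets.sigma_sets_subset[of "\<Union>t. sets (F t)" M]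
    by (auto simp: subalgebra_def setsG) (auto simp: G_def space_measure_of_conv)
  have subGF: "subalgebra G (F t)" for t
    using subG by (auto simp: subalgebra_def sp setsG)
  note sfs = sigma_finite_subalgebra_prob[OF prob_space_axioms sub]
  note sfsG = sigma_finite_subalgebra_prob[OF prob_space_axioms subG]
  define g where "g = real_cond_exp M G X"
  have g: "integrable M g" "g \<in> borel_measurable G" "g \<in> borel_measurable M"
    unfolding g_def using sigma_finite_subalgebra.real_cond_exp_int(1)[OF sfsG X] by auto
  define m where "m t = real_cond_exp M (F t) X" for t
  have m[measurable]: "m t \<in> borel_measurable M" for t unfolding m_def by simp
  note g(3)[measurable]
  have m_eq: "AE x in M. m t x = real_cond_exp M (F t) g x" for t
    using sigma_finite_subalgebra.real_cond_exp_nested_subalg[OF sfs subG subGF X, of t]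
    by (auto simp: m_def g_def elim: eventually_mono)
  \<comment> \<open>The points where the error exceeds \<open>2 * c\<close> infinitely often.\<close>
  define U where "U c = {x \<in> space M. \<forall>N. \<exists>t\<ge>N. 2 * c < \<bar>m t x - g x\<bar>}" for c
  have U[measurable]: "U c \<in> sets M" for c unfolding U_def by measurable
  have small: "prob (U c) \<le> 2 * (e / c)" if c: "0 < c" and e: "0 < e" for c e
  proof -
    from L1_approximation_by_filtration[OF sub mono g(1) g(2)[unfolded G_def] e]
    obtain s Z where Z: "Z \<in> borel_measurable (F s)" "integrable M Z"
        "expectation (\<lambda>x. \<bar>g x - Z x\<bar>) < e" .
    define W where "W x = \<bar>g x - Z x\<bar>" for x
    have W: "integrable M W" "\<And>x. 0 \<le> W x" "expectation W < e"
      unfolding W_def using g Z by auto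
    define V1 where "V1 = {x \<in> space M. \<exists>t. c < real_cond_exp M (F t) W x}"
    define V2 where "V2 = {x \<in> space M. c \<le> W x}"
    have V[measurable]: "V1 \<in> sets M" "V2 \<in> sets M"
      unfolding V1_def V2_def using W(1) by measurable
    have bound: "AE x in M. s \<le> t \<longrightarrow> \<bar>m t x - g x\<bar> \<le> real_cond_exp M (F t) W x + W x" for t
    proof (cases "s \<le> t")
      case True
      have Zt: "Z \<in> borel_measurable (F t)"
        using mono[OF True] by (intro measurable_from_subalg[OF _ Z(1)]) (simp add: subalgebra_def sp)
      interpret sigma_finite_subalgebra M "F t" by (rule sfs)
      have "AE x in M. real_cond_exp M (F t) Z x = Z x"
        using Z Zt by (intro real_cond_exp_F_meas) auto
      moreover have "AE x in M. real_cond_exp M (F t) (\<lambda>x. g x - Z x) x =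
          real_cond_exp M (F t) g x - real_cond_exp M (F t) Z x"
        using g Z by (intro real_cond_exp_diff) auto
      moreover have "AE x in M. real_cond_exp M (F t) (\<lambda>x. g x - Z x) x \<le> real_cond_exp M (F t) W x"
        using g Z W by (intro real_cond_exp_mono) (auto simp: W_def)
      moreover have "AE x in M. real_cond_exp M (F t) (\<lambda>x. (-1) * W x) x \<le> real_cond_exp M (F t) (\<lambda>x. g x - Z x) x"
        using g Z W by (intro real_cond_exp_mono) (auto simp: W_def)
      moreover have "AE x in M. real_cond_exp M (F t) (\<lambda>x. (-1) * W x) x = (-1) * real_cond_exp M (F t) W x"
        using W by (intro real_cond_exp_cmult) auto
      ultimately show ?thesis using m_eq[of t]
        by eventually_elim (auto simp: W_def)
    qed simp
    have "prob (U c) \<le> prob (V1 \<union> V2)"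
    proof (rule finite_measure_mono_AE)
      have "AE x in M. \<forall>t. s \<le> t \<longrightarrow> \<bar>m t x - g x\<bar> \<le> real_cond_exp M (F t) W x + W x"
        using bound by (simp add: AE_all_countable)
      then show "AE x in M. x \<in> U c \<longrightarrow> x \<in> V1 \<union> V2"
      proof eventually_elim
        case (elim x)
        show ?case
        proof
          assume x: "x \<in> U c"
          then obtain t where "s \<le> t" "2 * c < \<bar>m t x - g x\<bar>" by (auto simp: U_def)
          with elim have "2 * c < real_cond_exp M (F t) W x + W x" by fastforce
          then have "c < real_cond_exp M (F t) W x \<or> c \<le> W x" by linarith
          with x show "x \<in> V1 \<union> V2" by (auto simp: U_def V1_def V2_def)
        qed
      qed
    qed simp
    also have "\<dots> \<le> prob V1 + prob V2" by (rule measure_Un_le) auto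
    also have "prob V1 \<le> expectation W / c"
      unfolding V1_def by (rule cond_exp_maximal_inequality[OF sub mono W(1,2) c])
    also have "prob V2 \<le> expectation W / c"
      unfolding V2_def using W c by (intro integral_Markov_inequality_measure[of _ _ "{}"]) auto
    also have "expectation W / c \<le> e / c" using W c by (intro divide_right_mono) auto
    finally show ?thesis by simp
  qed
  have null: "AE x in M. x \<notin> U c" if c: "0 < c" for c
  proof -
    have "prob (U c) \<le> 0"
    proof (rule field_le_epsilon)
      fix e :: real assume "0 < e"
      with small[OF c, of "e * c / 2"] c show "prob (U c) \<le> 0 + e" by simp
    qed
    then have "prob (U c) = 0" using measure_nonneg[of M "U c"] by linarith
    then show ?thesis using U[of c]
      by (intro AE_not_in) (simp add: null_sets_def emeasure_eq_measure)
  qed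
  have "AE x in M. \<forall>k. x \<notin> U (inverse (real (Suc k)))"
    using null by (simp add: AE_all_countable)
  then show ?thesis using AE_space
  proof eventually_elim
    case (elim x)
    show ?case
    proof (rule LIMSEQ_I)
      fix r :: real assume "0 < r"
      then obtain k where k: "inverse (real (Suc k)) < r / 2"
        using reals_Archimedean[of "r / 2"] by auto
      define c where "c = inverse (real (Suc k))"
      have "x \<notin> U c" "x \<in> space M" using elim unfolding c_def by blast+
      then obtain N where N: "\<And>t. t \<ge> N \<Longrightarrow> \<bar>m t x - g x\<bar> \<le> 2 * c"
        unfolding U_def by (auto simp: not_less)
      have "norm (real_cond_exp M (F t) X x - real_cond_exp M G X x) < r" if "t \<ge> N" for t
        using N[OF that] k unfolding m_def g_def c_def[symmetric] real_norm_def by linarith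
      then show "\<exists>N. \<forall>t\<ge>N. norm (real_cond_exp M (F t) X x - real_cond_exp M G X x) < r"
        by blast
    qed
  qed
qed

section \<open>Generated sigma-algebras and conditional probabilities\<close>

lemma space_sigma_of [simp]: "space (sigma_of M \<X>) = space M"
  by (simp add: sigma_of_def space_measure_of_conv)

lemma sets_sigma_of:
  "sets (sigma_of M \<X>) = sigma_sets (space M) {X -` A \<inter> space M | X A. X \<in> \<X> \<and> A \<in> sets borel}"
  unfolding sigma_of_def by (rule sets_measure_of) auto

lemma measurable_sigma_of:
  fixes X :: "'w \<Rightarrow> 'b::topological_space"
  shows "X \<in> \<X> \<Longrightarrow> X \<in> borel_measurable (sigma_of M \<X>)"
  unfolding measurable_def
proof safe
  fix A :: "'b set" assume "X \<in> \<X>" "A \<in> sets borel"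
  then have "X -` A \<inter> space M \<in> {X -` A \<inter> space M | X A. X \<in> \<X> \<and> A \<in> sets borel}" by blast
  then show "X -` A \<inter> space (sigma_of M \<X>) \<in> sets (sigma_of M \<X>)"
    unfolding sets_sigma_of space_sigma_of by (rule sigma_sets.Basic)
qed simp

lemma subalgebra_sigma_of:
  assumes "\<And>X. X \<in> \<X> \<Longrightarrow> X \<in> borel_measurable N" "space N = space M"
  shows "subalgebra N (sigma_of M \<X>)"
proof -
  have "sigma_sets (space M) {X -` A \<inter> space M | X A. X \<in> \<X> \<and> A \<in> sets borel} \<subseteq> sets N"
    unfolding assms(2)[symmetric] using assms(1) by (intro sets.sigma_sets_subset) (auto intro: measurable_sets)
  then show ?thesis by (simp add: subalgebra_def sets_sigma_of assms(2))
qed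

lemma subalgebra_sigma_of_mono: "\<X> \<subseteq> \<Y> \<Longrightarrow> subalgebra (sigma_of M \<Y>) (sigma_of M \<X>)"
  by (rule subalgebra_sigma_of) (auto intro: measurable_sigma_of)

lemma (in prob_space) cond_prob_of_bounds:
  assumes "subalgebra M F" "B \<in> sets M"
  shows "AE x in M. 0 \<le> cond_prob_of M F B x" "AE x in M. cond_prob_of M F B x \<le> 1"
proof -
  interpret sigma_finite_subalgebra M F
    by (rule sigma_finite_subalgebra_prob[OF prob_space_axioms assms(1)])
  have "integrable M (indicat_real B)" using assms(2) by (simp add: emeasure_eq_measure)
  then show "AE x in M. 0 \<le> cond_prob_of M F B x" "AE x in M. cond_prob_of M F B x \<le> 1"
    unfolding cond_prob_of_def
    by (intro real_cond_exp_ge_c real_cond_exp_le_c AE_I2; auto simp: indicator_def)+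
qed

text \<open>The defining property of conditional probability, for functions instead of events: inside an
expectation, a factor known to \<open>F\<close> does not distinguish an event from its conditional probability.\<close>

lemma (in prob_space) integral_mult_cond_prob_of:
  assumes F: "subalgebra M F" and B: "B \<in> sets M"
    and Z: "Z \<in> borel_measurable F" "integrable M Z"
  shows "integrable M (\<lambda>x. Z x * cond_prob_of M F B x)"
    "expectation (\<lambda>x. Z x * cond_prob_of M F B x) = expectation (\<lambda>x. Z x * indicator B x)"
proof -
  interpret sigma_finite_subalgebra M F
    by (rule sigma_finite_subalgebra_prob[OF prob_space_axioms F])
  have int: "integrable M (\<lambda>x. Z x * indicator B x)"
    using integrable_real_mult_indicator[OF B Z(2)] by (simp add: mult.commute)
  show "integrable M (\<lambda>x. Z x * cond_prob_of M F B x)"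
    "expectation (\<lambda>x. Z x * cond_prob_of M F B x) = expectation (\<lambda>x. Z x * indicator B x)"
    unfolding cond_prob_of_def using B by (auto intro!: real_cond_exp_intg int Z)
qed

lemma cond_prob_of_measurable [measurable]:
  "cond_prob_of M F B \<in> borel_measurable F" "cond_prob_of M F B \<in> borel_measurable M"
  unfolding cond_prob_of_def by auto

lemma (in prob_space) integrable_cond_prob_of:
  assumes "subalgebra M F" "B \<in> sets M"
  shows "integrable M (cond_prob_of M F B)"
proof -
  have "integrable M (\<lambda>x. 1 * cond_prob_of M F B x)"
    by (rule integral_mult_cond_prob_of(1)[OF assms borel_measurable_const integrable_const])
  then show ?thesis by simp
qed

text \<open>Two finite signed measures that agree on an intersection-stable generator agree everywhere, so
a conditional expectation is already characterised by its integrals over a generator.\<close>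

lemma (in prob_space) real_cond_exp_eqI_generator:
  assumes F: "subalgebra M F" "sets F = sigma_sets (space M) G" and G: "Int_stable G" "space M \<in> G"
    and fg: "integrable M f" "integrable M g" "g \<in> borel_measurable F"
    and eq: "\<And>D. D \<in> G \<Longrightarrow> (\<integral>x\<in>D. f x \<partial>M) = (\<integral>x\<in>D. (g x :: real) \<partial>M)"
  shows "AE x in M. real_cond_exp M F f x = g x"
proof -
  interpret sigma_finite_subalgebra M F
    by (rule sigma_finite_subalgebra_prob[OF prob_space_axioms F(1)])
  have sub: "sigma_sets (space M) G \<subseteq> sets M"
    using F by (auto simp: subalgebra_def)
  then have gen: "G \<subseteq> Pow (space M)"
    using sets.sets_into_space by blast
  have int: "set_integrable M D h" if "D \<in> sets M" "integrable M h" for D and h :: "'a \<Rightarrow> real"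
    unfolding set_integrable_def using that by (rule integrable_mult_indicator)
  have "(\<integral>x\<in>D. f x \<partial>M) = (\<integral>x\<in>D. g x \<partial>M)" if "D \<in> sigma_sets (space M) G" for D
    using G(1) gen that
  proof (induction rule: sigma_sets_induct_disjoint)
    case (basic A)
    then show ?case by (rule eq)
  next
    case empty
    show ?case by (simp add: set_lebesgue_integral_def)
  next
    case (compl A)
    have A: "A \<in> sets M" "A \<subseteq> space M" using compl.hyps sub sets.sets_into_space by blast+
    have split: "(\<integral>x\<in>space M - A. h x \<partial>M) = (\<integral>x\<in>space M. h x \<partial>M) - (\<integral>x\<in>A. h x \<partial>M)"
      if h: "integrable M h" for h :: "'a \<Rightarrow> real"
    proof -
      have "(\<integral>x\<in>(space M - A) \<union> A. h x \<partial>M) = (\<integral>x\<in>space M - A. h x \<partial>M) + (\<integral>x\<in>A. h x \<partial>M)"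
        using A h by (intro set_integral_Un int) auto
      moreover have "(space M - A) \<union> A = space M" using A by auto
      ultimately show ?thesis by simp
    qed
    show ?case using compl.IH eq[OF G(2)] fg by (simp add: split)
  next
    case (union A)
    have A: "A i \<in> sets M" for i using union.hyps sub by auto
    have split: "(\<integral>x\<in>(\<Union>i. A i). h x \<partial>M) = (\<Sum>i. (\<integral>x\<in>A i. h x \<partial>M))"
      if h: "integrable M h" for h :: "'a \<Rightarrow> real"
      using A h union.hyps(1) by (intro lebesgue_integral_countable_add int) (auto simp: disjoint_family_on_def)
    show ?case using union.IH fg by (simp add: split)
  qed
  then show ?thesis
    using fg F(2) by (intro real_cond_exp_charact) auto
qed

lemma (in prob_space) cond_prob_of_compl:
  assumes F: "subalgebra M F" and B: "B \<in> sets M"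
  shows "AE x in M. cond_prob_of M F (space M - B) x = 1 - cond_prob_of M F B x"
proof -
  interpret sigma_finite_subalgebra M F
    by (rule sigma_finite_subalgebra_prob[OF prob_space_axioms F])
  have iB: "integrable M (indicat_real B)" using B by (simp add: emeasure_eq_measure)
  have "AE x in M. real_cond_exp M F (indicat_real (space M - B)) x = real_cond_exp M F (\<lambda>x. 1 - indicat_real B x) x"
    using B by (intro real_cond_exp_cong) (auto simp: indicator_def)
  moreover have "AE x in M. real_cond_exp M F (\<lambda>x. 1 - indicat_real B x) x = real_cond_exp M F (\<lambda>x. 1) x - real_cond_exp M F (indicat_real B) x"
    using iB by (intro real_cond_exp_diff) auto
  moreover have "AE x in M. real_cond_exp M F (\<lambda>x. 1 :: real) x = 1"
    by (intro real_cond_exp_F_meas) auto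
  ultimately show ?thesis unfolding cond_prob_of_def by eventually_elim simp
qed

text \<open>The Bayes law and finite information only speak of sets of states with probability strictly between
\<open>0\<close> and \<open>1\<close>; these two cases cover the remaining ones.\<close>

lemma (in prob_space) cond_prob_of_trivial:
  assumes F: "subalgebra M F" and B: "B \<in> sets M"
  shows "prob B = 0 \<Longrightarrow> AE x in M. cond_prob_of M F B x = 0"
    "prob B = 1 \<Longrightarrow> AE x in M. cond_prob_of M F B x = 1"
proof -
  have zero: "AE x in M. cond_prob_of M F B x = 0" if B: "B \<in> sets M" "prob B = 0" for B
  proof -
    have "expectation (\<lambda>x. 1 * cond_prob_of M F B x) = expectation (\<lambda>x. 1 * indicat_real B x)"
      by (rule integral_mult_cond_prob_of(2)[OF F B(1) borel_measurable_const integrable_const])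
    then have "expectation (cond_prob_of M F B) = 0"
      using B sets.sets_into_space[OF B(1)] by (simp add: Int_absorb2)
    then show ?thesis
      using integral_nonneg_eq_0_iff_AE[OF integrable_cond_prob_of[OF F B(1)] cond_prob_of_bounds(1)[OF F B(1)]]
      by simp
  qed
  then show "prob B = 0 \<Longrightarrow> AE x in M. cond_prob_of M F B x = 0" using B by blast
  assume "prob B = 1"
  then have "AE x in M. cond_prob_of M F (space M - B) x = 0"
    using B by (intro zero) (auto simp: prob_compl)
  then show "AE x in M. cond_prob_of M F B x = 1"
    using cond_prob_of_compl[OF F B] by eventually_elim simp
qed

lemma is_cond_law_measure:
  assumes "is_cond_law M F N X K"
  shows "A \<in> sets N \<Longrightarrow> AE \<omega> in M. measure (K \<omega>) A = cond_prob_of M F (X -` A \<inter> space M) \<omega>"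
    "\<omega> \<in> space F \<Longrightarrow> prob_space (K \<omega>)" "\<omega> \<in> space F \<Longrightarrow> sets (K \<omega>) = sets N"
  using assms measurable_space[of K F "prob_algebra N" \<omega>]
  by (auto simp: is_cond_law_def space_prob_algebra)

lemma (in prob_space) integral_cong_AE_mult:
  assumes "AE x in M. g x = g' x" "g \<in> borel_measurable M" "g' \<in> borel_measurable M" "f \<in> borel_measurable M"
  shows "expectation (\<lambda>x. f x * g x :: real) = expectation (\<lambda>x. f x * g' x)"
  using assms(2-) by (intro integral_cong_AE) (use assms(1) in \<open>auto elim: eventually_mono\<close>)

lemma measure_PiM_PiE:
  assumes "finite I" "\<And>i. i \<in> I \<Longrightarrow> prob_space (N i)" "\<And>i. i \<in> I \<Longrightarrow> C i \<in> sets (N i)"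
  shows "measure (\<Pi>\<^sub>M i\<in>I. N i) (\<Pi>\<^sub>E i\<in>I. C i) = (\<Prod>i\<in>I. measure (N i) (C i))"
proof -
  \<comment> \<open>Product measures are set up for families of probability measures indexed by a whole type, so the family is extended by a point mass outside \<open>I\<close>.\<close>
  define N' where "N' i = (if i \<in> I then N i else return (count_space UNIV) undefined)" for i
  have "prob_space (N' i)" for i
    using assms(2) by (auto simp: N'_def intro!: prob_space_return)
  then interpret finite_product_prob_space N' I
    by (intro finite_product_prob_space.intro product_prob_space.intro product_prob_space_axioms.intro
      product_sigma_finite.intro finite_product_sigma_finite.intro finite_product_sigma_finite_axioms.intro
      prob_space_imp_sigma_finite assms(1))
  have "(\<Pi>\<^sub>M i\<in>I. N i) = (\<Pi>\<^sub>M i\<in>I. N' i)"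
    by (intro PiM_cong) (auto simp: N'_def)
  moreover have "measure (\<Pi>\<^sub>M i\<in>I. N' i) (\<Pi>\<^sub>E i\<in>I. C i) = (\<Prod>i\<in>I. measure (N' i) (C i))"
    using assms(3) by (intro prob_times) (auto simp: N'_def)
  ultimately show ?thesis by (simp add: N'_def cong: prod.cong)
qed

section \<open>Posteriors shared by all observers\<close>

text \<open>Observers with information \<open>H i\<close> estimate \<open>q\<close> and all arrive at the same estimate \<open>p k\<close>. If the
log-odds of \<open>q\<close> split into terms each of which is known to one observer, the estimate is exact. The
error \<open>q - p k\<close> is orthogonal to everything that any one of the observers knows, in particular to every \<open>L i\<close>
and to the log-odds of \<open>p k\<close>, hence to the difference of the two log-odds; but this difference
always has the sign of the error. Since the log-odds of \<open>p k\<close> need not be integrable, the argument is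
run on the events \<open>p k \<in> {a..1 - a}\<close>, which all observers can recognise.\<close>

lemma (in prob_space) common_posterior_eq_full_posterior:
  assumes I: "finite I" "k \<in> I"
    and H: "\<And>i. i \<in> I \<Longrightarrow> subalgebra M (H i)"
    and q: "integrable M q" "AE x in M. 0 < q x" "AE x in M. q x < (1::real)"
    and p: "\<And>i. i \<in> I \<Longrightarrow> p i \<in> borel_measurable (H i)"
      "\<And>i. i \<in> I \<Longrightarrow> AE x in M. real_cond_exp M (H i) q x = p i x"
    and agree: "\<And>i. i \<in> I \<Longrightarrow> AE x in M. p i x = p k x"
    and L: "\<And>i. i \<in> I \<Longrightarrow> L i \<in> borel_measurable (H i)" "\<And>i. i \<in> I \<Longrightarrow> integrable M (L i)"
    and logit: "AE x in M. ln (q x) - ln (1 - q x) = (\<Sum>i\<in>I. L i x) + c"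
  shows "AE x in M. p k x = q x"
proof -
  have pM: "p i \<in> borel_measurable M" if "i \<in> I" for i
    using measurable_from_subalg[OF H p(1)] that by blast
  have qM: "q \<in> borel_measurable M" using q(1) by auto
  interpret sigma_finite_subalgebra M "H k"
    by (rule sigma_finite_subalgebra_prob[OF prob_space_axioms H[OF I(2)]])
  have pk01: "AE x in M. 0 < p k x" "AE x in M. p k x < 1"
    using real_cond_exp_gr_c[OF q(1,2)] real_cond_exp_less_c[OF q(1,3)] p(2)[OF I(2)]
    by (eventually_elim; simp)+
  \<comment> \<open>Conditioning on \<open>H i\<close> replaces \<open>q\<close> by \<open>p i\<close>, which agreement identifies with \<open>p k\<close>.\<close>
  have orth: "integrable M (\<lambda>x. Z x * (q x - p k x))" "expectation (\<lambda>x. Z x * (q x - p k x)) = 0"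
    if i: "i \<in> I" and Z: "Z \<in> borel_measurable (H i)" "integrable M Z" for i Z
  proof -
    interpret Hi: sigma_finite_subalgebra M "H i"
      by (rule sigma_finite_subalgebra_prob[OF prob_space_axioms H[OF i]])
    have ZM: "Z \<in> borel_measurable M" using Z(2) by auto
    have int: "integrable M (\<lambda>x. Z x * q x)"
    proof (rule Bochner_Integration.integrable_bound[OF Z(2)])
      show "AE x in M. norm (Z x * q x) \<le> norm (Z x)"
        using q(2,3) by eventually_elim (simp add: abs_mult mult_left_le)
    qed (use ZM qM in measurable)
    have e: "AE x in M. Z x * real_cond_exp M (H i) q x = Z x * p k x"
      using p(2)[OF i] agree[OF i] by eventually_elim simp
    have mm: "(\<lambda>x. Z x * p k x) \<in> borel_measurable M" using ZM pM[OF I(2)] by measurable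
    have "integrable M (\<lambda>x. Z x * p k x)"
      using Hi.real_cond_exp_intg(1)[OF int Z(1) qM] e mm by (subst integrable_cong_AE[symmetric]) auto
    moreover have "expectation (\<lambda>x. Z x * p k x) = expectation (\<lambda>x. Z x * q x)"
      using Hi.real_cond_exp_intg(2)[OF int Z(1) qM] e mm ZM
      by (subst integral_cong_AE[of "\<lambda>x. Z x * p k x" M "\<lambda>x. Z x * real_cond_exp M (H i) q x"]) auto
    ultimately show "integrable M (\<lambda>x. Z x * (q x - p k x))" "expectation (\<lambda>x. Z x * (q x - p k x)) = 0"
      using int by (simp_all add: right_diff_distrib)
  qed
  have on_level: "AE x in M. p k x \<in> {a..1 - a} \<longrightarrow> p k x = q x" if a: "0 < a" for a
  proof -
    define \<phi> where "\<phi> = (indicator {a..1 - a} :: real \<Rightarrow> real)"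
    have \<phi>[measurable]: "\<phi> \<in> borel_measurable borel" unfolding \<phi>_def by measurable
    have \<phi>01: "0 \<le> \<phi> y" "\<phi> y \<le> 1" for y by (auto simp: \<phi>_def)
    \<comment> \<open>The truncated log-odds of \<open>p k\<close> minus \<open>c\<close>, as a function of \<open>p k\<close>; truncation makes it bounded by \<open>\<bar>ln a\<bar> + \<bar>c\<bar>\<close>.\<close>
    define \<psi> where "\<psi> y = \<phi> y * (ln y - ln (1 - y) - c)" for y
    have \<psi>[measurable]: "\<psi> \<in> borel_measurable borel" unfolding \<psi>_def by measurable
    have \<psi>_bound: "\<bar>\<psi> y\<bar> \<le> \<bar>ln a\<bar> + \<bar>c\<bar>" for y
    proof (cases "y \<in> {a..1 - a}")
      case True
      then have "ln a \<le> ln y" "ln a \<le> ln (1 - y)" "ln y \<le> 0" "ln (1 - y) \<le> 0"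
        using a by auto
      then show ?thesis using True by (simp add: \<psi>_def \<phi>_def)
    qed (simp add: \<psi>_def \<phi>_def)
    have i1: "integrable M (\<lambda>x. \<phi> (p k x) * L i x * (q x - p k x))"
       "expectation (\<lambda>x. \<phi> (p k x) * L i x * (q x - p k x)) = 0" if i: "i \<in> I" for i
    proof -
      have m: "(\<lambda>x. \<phi> (p i x) * L i x) \<in> borel_measurable (H i)"
        using p(1)[OF i] L(1)[OF i] by measurable
      have mM: "(\<lambda>x. \<phi> (p i x) * L i x) \<in> borel_measurable M"
        by (rule measurable_from_subalg[OF H[OF i] m])
      have "integrable M (\<lambda>x. \<phi> (p i x) * L i x)"
        using \<phi>01 mM by (intro Bochner_Integration.integrable_bound[OF L(2)[OF i]])
          (auto simp: abs_mult mult_left_le_one_le)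
      note o = orth[OF i m this]
      have LM: "L i \<in> borel_measurable M" using L(2)[OF i] by auto
      have e: "AE x in M. \<phi> (p i x) * L i x * (q x - p k x) = \<phi> (p k x) * L i x * (q x - p k x)"
        using agree[OF i] by eventually_elim simp
      have mm: "(\<lambda>x. \<phi> (p k x) * L i x * (q x - p k x)) \<in> borel_measurable M"
          "(\<lambda>x. \<phi> (p i x) * L i x * (q x - p k x)) \<in> borel_measurable M"
        using LM pM[OF I(2)] pM[OF i] qM by measurable
      show "integrable M (\<lambda>x. \<phi> (p k x) * L i x * (q x - p k x))"
        using o(1) e mm by (subst integrable_cong_AE[symmetric]) auto
      show "expectation (\<lambda>x. \<phi> (p k x) * L i x * (q x - p k x)) = 0"
        unfolding o(2)[symmetric] using e mm by (intro integral_cong_AE) auto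
    qed
    have \<psi>H: "(\<lambda>x. \<psi> (p k x)) \<in> borel_measurable (H k)"
      using p(1)[OF I(2)] by measurable
    have \<psi>i: "integrable M (\<lambda>x. \<psi> (p k x))"
      using \<psi>_bound measurable_from_subalg[OF H[OF I(2)] \<psi>H]
      by (intro integrable_const_bound[of _ "\<bar>ln a\<bar> + \<bar>c\<bar>"]) auto
    note i2 = orth[OF I(2) \<psi>H \<psi>i]
    \<comment> \<open>The truncated product of the error with the difference of the log-odds, written as a combination of integrable terms of mean zero; the constant \<open>c\<close> is hidden in \<open>\<psi>\<close>.\<close>
    define h where "h x = (\<Sum>i\<in>I. \<phi> (p k x) * L i x * (q x - p k x)) - \<psi> (p k x) * (q x - p k x)" for x
    have h: "integrable M h" "expectation h = 0"
      unfolding h_def using i1 i2 by auto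
    have heq: "AE x in M. h x = \<phi> (p k x) * ((ln (q x) - ln (p k x)) + (ln (1 - p k x) - ln (1 - q x))) * (q x - p k x)"
      using logit
    proof eventually_elim
      case (elim x)
      have "h x = \<phi> (p k x) * ((\<Sum>i\<in>I. L i x) + c - (ln (p k x) - ln (1 - p k x))) * (q x - p k x)"
        unfolding h_def \<psi>_def sum_distrib_right[symmetric] sum_distrib_left[symmetric] by (simp add: algebra_simps)
      then show ?case unfolding elim[symmetric] by (simp add: algebra_simps)
    qed
    have "AE x in M. 0 \<le> h x \<and> (h x = 0 \<longrightarrow> p k x \<in> {a..1 - a} \<longrightarrow> p k x = q x)"
      using heq q(2,3) pk01
    proof eventually_elim
      case (elim x)
      define r where "r = (ln (q x) - ln (p k x)) + (ln (1 - p k x) - ln (1 - q x))"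
      have hr: "h x = \<phi> (p k x) * (r * (q x - p k x))" using elim by (simp add: r_def mult.assoc)
      consider "p k x < q x" | "p k x = q x" | "q x < p k x" by linarith
      then show ?case
      proof cases
        case 1
        with elim have "0 < r" unfolding r_def by (intro add_pos_pos) (auto simp: ln_less_cancel_iff)
        with 1 have "0 < r * (q x - p k x)" by simp
        then show ?thesis using \<phi>01(1)[of "p k x"] by (auto simp: hr \<phi>_def)
      next
        case 3
        with elim have "0 < - r" unfolding r_def minus_add_distrib
          by (intro add_pos_pos) auto
        with 3 have "0 < r * (q x - p k x)" by (simp add: mult_neg_neg)
        then show ?thesis using \<phi>01(1)[of "p k x"] by (auto simp: hr \<phi>_def)
      qed (auto simp: hr)
    qed
    moreover from this have "AE x in M. h x = 0"
      using integral_nonneg_eq_0_iff_AE[OF h(1)] h(2) by (auto elim: eventually_mono)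
    ultimately show ?thesis by eventually_elim auto
  qed
  define a where "a m = inverse (real (Suc m))" for m
  have "AE x in M. \<forall>m. p k x \<in> {a m..1 - a m} \<longrightarrow> p k x = q x"
    unfolding AE_all_countable using on_level by (simp add: a_def)
  then show ?thesis using pk01
  proof eventually_elim
    case (elim x)
    then have "0 < min (p k x) (1 - p k x)" by simp
    then obtain m where "a m < min (p k x) (1 - p k x)"
      unfolding a_def using reals_Archimedean by blast
    then have "p k x \<in> {a m..1 - a m}" by auto
    with elim(1) show ?case by blast
  qed
qed

section \<open>Histories of the sampling model\<close>

text \<open>Everything that is public or private in the network before round \<open>t\<close>, except the state itself. It
lies between the information of any single agent and the global history, and differs from the latter
exactly in that it leaves \<open>\<theta>\<close> to be estimated.\<close>

definition communication_history ::
  "'w measure \<Rightarrow> nat set \<Rightarrow> (nat \<Rightarrow> 'w \<Rightarrow> 'b::topological_space) \<Rightarrow> (nat \<Rightarrow> nat \<Rightarrow> 'w \<Rightarrow> 'b)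
     \<Rightarrow> nat \<Rightarrow> 'w measure" where
  "communication_history M agents S Y t = sigma_of M (S ` agents \<union> {Y j s | j s. j \<in> agents \<and> 1 \<le> s \<and> s < t})"

context sampling_model
begin

text \<open>Naming the vertex set keeps the simplifier from rewriting \<open>{1..n}\<close> inside the generated
\<open>\<sigma>\<close>-algebras.\<close>

definition "agents = {1..n}"

lemma finite_agents [simp]: "finite agents" by (simp add: agents_def)

lemmas signal_measurable_agents = signal_measurable[folded agents_def]
lemmas sample_measurable_agents = sample_measurable[folded agents_def]
lemmas posterior_agents = posterior[folded agents_def]
lemmas sample_law_agents = sample_law[folded agents_def]

abbreviation "info \<equiv> agent_info M E S Y"
abbreviation "info_limit \<equiv> agent_info_limit M E S Y"
abbreviation "history \<equiv> global_history M agents \<theta> S Y"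
abbreviation "signal_info \<equiv> sigma_of M (S ` agents)"
abbreviation "comm \<equiv> communication_history M agents S Y"

lemma edges: "(i, j) \<in> E \<Longrightarrow> i \<in> agents \<and> j \<in> agents"
  using graph by (auto simp: simple_graph_def agents_def)

lemma edge_sym: "(i, j) \<in> E \<Longrightarrow> (j, i) \<in> E"
  using graph by (auto simp: simple_graph_def sym_def)

lemma subalgebra_history: "subalgebra M (history t)"
  unfolding global_history_def
  by (rule subalgebra_sigma_of) (auto simp: state_measurable intro: signal_measurable_agents sample_measurable_agents)

lemma subalgebra_comm: "subalgebra M (comm t)"
  unfolding communication_history_def
  by (rule subalgebra_sigma_of) (auto intro: signal_measurable_agents sample_measurable_agents)

lemma subalgebra_signal: "subalgebra M signal_info"
  by (rule subalgebra_sigma_of) (auto intro: signal_measurable_agents)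

lemma subalgebra_history_comm: "subalgebra (history t) (comm t)"
  unfolding communication_history_def global_history_def
  by (intro subalgebra_sigma_of_mono) blast

lemma subalgebra_comm_signal: "subalgebra (comm t) signal_info"
  unfolding communication_history_def
  by (intro subalgebra_sigma_of_mono) blast

lemma subalgebra_comm_info: "i \<in> agents \<Longrightarrow> subalgebra (comm t) (info i t)"
  unfolding communication_history_def agent_info_def
  using edges by (intro subalgebra_sigma_of_mono) blast

lemma subalgebra_info: "i \<in> agents \<Longrightarrow> subalgebra M (info i t)"
  unfolding agent_info_def
  by (rule subalgebra_sigma_of) (auto intro: signal_measurable_agents sample_measurable_agents dest: edges)

lemma subalgebra_info_signal: "i \<in> agents \<Longrightarrow> subalgebra (info i t) (sigma_of M {S i})"
  unfolding agent_info_def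
  by (intro subalgebra_sigma_of_mono) blast

lemma info_mono: "s \<le> t \<Longrightarrow> sets (info i s) \<subseteq> sets (info i t)"
proof -
  assume "s \<le> t"
  then have "subalgebra (info i t) (info i s)"
    unfolding agent_info_def by (intro subalgebra_sigma_of_mono) (auto intro: less_le_trans)
  then show ?thesis by (simp add: subalgebra_def)
qed

lemma space_info [simp]: "space (info i t) = space M"
  by (simp add: agent_info_def)

text \<open>The union in the definition starts at time \<open>1\<close>. Starting at time \<open>0\<close> adds nothing, as the
information at both times consists of the private signal only.\<close>

lemma info_limit_eq: "info_limit i = sigma (space M) (\<Union>t. sets (info i t))"
proof -
  have "(\<Union>t\<in>{1..}. sets (info i t)) = (\<Union>t. sets (info i t))"
  proof (intro equalityI UN_least)
    fix t show "sets (info i t) \<subseteq> (\<Union>t\<in>{1..}. sets (info i t))"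
      using info_mono[of t "max 1 t" i] by (rule order_trans[OF _ UN_upper]) auto
  qed auto
  then show ?thesis by (simp add: agent_info_limit_def)
qed

lemma sets_info_limit: "sets (info_limit i) = sigma_sets (space M) (\<Union>t. sets (info i t))"
proof -
  have "(\<Union>t. sets (info i t)) \<subseteq> Pow (space M)"
    by (intro UN_least) (metis sets.space_closed space_info)
  then show ?thesis unfolding info_limit_eq by (rule sets_measure_of)
qed

lemma space_info_limit [simp]: "space (info_limit i) = space M"
  by (simp add: agent_info_limit_def space_measure_of_conv)

lemma subalgebra_info_limit: "i \<in> agents \<Longrightarrow> subalgebra M (info_limit i)"
proof -
  assume "i \<in> agents"
  then have "(\<Union>t. sets (info i t)) \<subseteq> sets M"
    using subalgebra_info by (auto simp: subalgebra_def)
  then show ?thesis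
    by (simp add: subalgebra_def sets_info_limit sets.sigma_sets_subset)
qed

lemma subalgebra_info_limit_info: "subalgebra (info_limit i) (info i t)"
  by (auto simp: subalgebra_def sets_info_limit)

lemma info_union_Int_stable: "Int_stable (\<Union>t. sets (info i t))"
proof (rule Int_stableI)
  fix a b assume "a \<in> (\<Union>t. sets (info i t))" "b \<in> (\<Union>t. sets (info i t))"
  then obtain s t where "a \<in> sets (info i s)" "b \<in> sets (info i t)" by auto
  then have "a \<in> sets (info i (max s t))" "b \<in> sets (info i (max s t))"
    using info_mono[of s "max s t" i] info_mono[of t "max s t" i] by auto
  then show "a \<inter> b \<in> (\<Union>t. sets (info i t))" by auto
qed

lemma sample_measurable_info_limit:
  assumes "(i, j) \<in> E" "1 \<le> t"
  shows "Y j t \<in> borel_measurable (info_limit i)"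
proof -
  have "Y j t \<in> borel_measurable (info i (Suc t))"
    unfolding agent_info_def using assms by (intro measurable_sigma_of) auto
  then show ?thesis by (rule measurable_from_subalg[OF subalgebra_info_limit_info])
qed

definition state_event :: "(real ^ 'd) set \<Rightarrow> 'w set" where
  "state_event A = \<theta> -` A \<inter> space M"

lemma state_event [measurable]: "A \<in> sets borel \<Longrightarrow> state_event A \<in> sets M"
  unfolding state_event_def by (rule measurable_sets[OF state_measurable])

lemma state_event_history: "A \<in> sets borel \<Longrightarrow> state_event A \<in> sets (history t)"
proof -
  assume A: "A \<in> sets borel"
  have "\<theta> \<in> borel_measurable (history t)"
    unfolding global_history_def by (intro measurable_sigma_of) auto
  from measurable_sets[OF this A] show ?thesis
    by (simp add: state_event_def global_history_def)
qed

lemma posterior_space: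
  assumes "i \<in> agents" "1 \<le> t" "\<omega> \<in> space M"
  shows "prob_space (\<mu> i t \<omega>)" "sets (\<mu> i t \<omega>) = sets borel"
proof -
  have "\<mu> i t \<in> info i t \<rightarrow>\<^sub>M prob_algebra borel"
    using posterior_agents[OF assms(1,2)] by (simp add: is_cond_law_def)
  then have "\<mu> i t \<omega> \<in> space (prob_algebra borel)"
    by (rule measurable_space) (simp add: assms(3))
  then show "prob_space (\<mu> i t \<omega>)" "sets (\<mu> i t \<omega>) = sets borel"
    by (auto simp: space_prob_algebra)
qed

lemma posterior_measurable:
  assumes "i \<in> agents" "1 \<le> t" "A \<in> sets borel"
  shows "(\<lambda>\<omega>. measure (\<mu> i t \<omega>) A) \<in> borel_measurable (info i t)"
proof -
  have "\<mu> i t \<in> info i t \<rightarrow>\<^sub>M prob_algebra borel"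
    using posterior_agents[OF assms(1,2)] by (simp add: is_cond_law_def)
  then show ?thesis by (rule measurable_compose) (rule measurable_measure_prob_algebra[OF assms(3)])
qed

lemma posterior_AE:
  assumes "i \<in> agents" "1 \<le> t" "A \<in> sets borel"
  shows "AE \<omega> in M. measure (\<mu> i t \<omega>) A = cond_prob_of M (info i t) (state_event A) \<omega>"
  using posterior_agents[OF assms(1,2)] assms(3) unfolding is_cond_law_def state_event_def by blast

definition sample_event :: "nat \<Rightarrow> (nat \<Rightarrow> (real ^ 'd) set) \<Rightarrow> 'w set" where
  "sample_event t C = {\<omega> \<in> space M. \<forall>i\<in>agents. Y i t \<omega> \<in> C i}"

lemma sample_event_measurable:
  assumes "1 \<le> t" "\<And>i. i \<in> agents \<Longrightarrow> C i \<in> sets borel"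
  shows "sample_event t C \<in> sets (comm (Suc t))"
proof -
  have "Y i t \<in> borel_measurable (comm (Suc t))" if "i \<in> agents" for i
    unfolding communication_history_def using assms that by (intro measurable_sigma_of) auto
  then have "Y i t -` C i \<inter> space (comm (Suc t)) \<in> sets (comm (Suc t))" if "i \<in> agents" for i
    using assms(2) that by (blast intro: measurable_sets)
  then have "{\<omega> \<in> space (comm (Suc t)). \<forall>i\<in>agents. Y i t \<omega> \<in> C i} \<in> sets (comm (Suc t))"
    by (intro sets.sets_Collect_finite_All) (auto simp: vimage_def Int_def conj_commute)
  then show ?thesis by (simp add: sample_event_def communication_history_def)
qed

text \<open>Given the past, the samples of one round are independent draws from the agents' posteriors.\<close>

lemma cond_prob_sample_event:
  assumes t: "1 \<le> t" and C: "\<And>i. i \<in> agents \<Longrightarrow> C i \<in> sets borel"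
  shows "AE \<omega> in M. cond_prob_of M (history t) (sample_event t C) \<omega> = (\<Prod>i\<in>agents. measure (\<mu> i t \<omega>) (C i))"
proof -
  have "Pi\<^sub>E agents C \<in> sets (\<Pi>\<^sub>M i\<in>agents. (borel :: (real ^ 'd) measure))"
    using C by (intro sets_PiM_I_finite) auto
  then have "AE \<omega> in M. measure (\<Pi>\<^sub>M i\<in>agents. \<mu> i t \<omega>) (Pi\<^sub>E agents C) =
      cond_prob_of M (history t) ((\<lambda>\<omega>. \<lambda>i\<in>agents. Y i t \<omega>) -` Pi\<^sub>E agents C \<inter> space M) \<omega>"
    using sample_law_agents[OF t] unfolding is_cond_law_def by blast
  moreover have "(\<lambda>\<omega>. \<lambda>i\<in>agents. Y i t \<omega>) -` Pi\<^sub>E agents C \<inter> space M = sample_event t C"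
    by (auto simp: sample_event_def PiE_iff)
  ultimately have "AE \<omega> in M. measure (\<Pi>\<^sub>M i\<in>agents. \<mu> i t \<omega>) (Pi\<^sub>E agents C) =
      cond_prob_of M (history t) (sample_event t C) \<omega>" by simp
  then show ?thesis using AE_space
  proof eventually_elim
    case (elim \<omega>)
    have "measure (\<Pi>\<^sub>M i\<in>agents. \<mu> i t \<omega>) (Pi\<^sub>E agents C) = (\<Prod>i\<in>agents. measure (\<mu> i t \<omega>) (C i))"
      using posterior_space[OF _ t elim(2)] C by (intro measure_PiM_PiE) auto
    with elim show ?case by simp
  qed
qed

section \<open>The samples add nothing to the signals\<close>

lemma sample_event_in_M:
  assumes "1 \<le> t" "\<And>i. i \<in> agents \<Longrightarrow> C i \<in> sets borel"
  shows "sample_event t C \<in> sets M"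
  using sample_event_measurable[of t C] assms subalgebra_comm[of "Suc t"] unfolding subalgebra_def by blast

lemma posterior_product_measurable:
  assumes t: "1 \<le> t" and C: "\<And>i. i \<in> agents \<Longrightarrow> C i \<in> sets borel"
  shows "(\<lambda>\<omega>. \<Prod>i\<in>agents. measure (\<mu> i t \<omega>) (C i)) \<in> borel_measurable (comm t)"
proof (intro borel_measurable_prod measurable_from_subalg[OF subalgebra_comm_info])
  show "(\<lambda>\<omega>. measure (\<mu> i t \<omega>) (C i)) \<in> borel_measurable (info i t)" if "i \<in> agents" for i
    by (rule posterior_measurable[OF that t C[OF that]])
qed simp_all

lemma posterior_product_le_1:
  assumes t: "1 \<le> t" and "\<omega> \<in> space M"
  shows "(\<Prod>i\<in>agents. measure (\<mu> i t \<omega>) (C i)) \<le> 1"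
  using posterior_space[OF _ assms] by (intro prod_le_1) (auto intro: prob_space.prob_le_1)

text \<open>The form in which the sampling rule is used below: against any function of the past, the event that
the samples of round \<open>t\<close> fall into a given rectangle may be replaced by the product of the
posterior probabilities, which is itself determined by signals and earlier samples.\<close>

lemma integral_sample_event:
  assumes t: "1 \<le> t" and C: "\<And>i. i \<in> agents \<Longrightarrow> C i \<in> sets borel"
    and Z: "Z \<in> borel_measurable (history t)" "integrable M Z"
  shows "expectation (\<lambda>\<omega>. Z \<omega> * indicator (sample_event t C) \<omega>) =
    expectation (\<lambda>\<omega>. Z \<omega> * (\<Prod>i\<in>agents. measure (\<mu> i t \<omega>) (C i)))"
proof -
  have "expectation (\<lambda>\<omega>. Z \<omega> * indicator (sample_event t C) \<omega>) =
      expectation (\<lambda>\<omega>. Z \<omega> * cond_prob_of M (history t) (sample_event t C) \<omega>)"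
    by (rule integral_mult_cond_prob_of(2)[symmetric, OF subalgebra_history sample_event_in_M[OF t C] Z])
  also have "\<dots> = expectation (\<lambda>\<omega>. Z \<omega> * (\<Prod>i\<in>agents. measure (\<mu> i t \<omega>) (C i)))"
    by (rule integral_cong_AE_mult[OF cond_prob_sample_event[OF t C] cond_prob_of_measurable(2)
        measurable_from_subalg[OF subalgebra_comm posterior_product_measurable[OF t C]]
        borel_measurable_integrable[OF Z(2)]])
  finally show ?thesis .
qed

lemma comm_early: "t \<le> 1 \<Longrightarrow> comm t = signal_info"
proof -
  assume "t \<le> 1"
  then have "S ` agents \<union> {Y j s | j s. j \<in> agents \<and> 1 \<le> s \<and> s < t} = S ` agents" by auto
  then show ?thesis by (simp only: communication_history_def)
qed

lemma comm_mono: "subalgebra (comm (Suc t)) (comm t)"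
  unfolding communication_history_def by (intro subalgebra_sigma_of_mono) (auto intro: less_SucI)

text \<open>An intersection-stable generator of the history after round \<open>t\<close>: an event of the history before that round,
intersected with a rectangle for the samples of the round.\<close>

definition round_generator :: "nat \<Rightarrow> 'w set set" where
  "round_generator t = {D \<inter> sample_event t C | D C. D \<in> sets (comm t) \<and> (\<forall>i\<in>agents. C i \<in> sets borel)}"

lemma round_generatorI:
  assumes "D \<in> sets (comm t)" "\<And>i. i \<in> agents \<Longrightarrow> C i \<in> sets borel"
  shows "D \<inter> sample_event t C \<in> round_generator t"
  using assms unfolding round_generator_def by blast

lemma space_comm [simp]: "space (comm t) = space M"
  by (simp add: communication_history_def)

lemma sets_comm_Suc:
  assumes t: "1 \<le> t"
  shows "sets (comm (Suc t)) = sigma_sets (space M) (round_generator t)"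
proof
  have "round_generator t \<subseteq> sets (comm (Suc t))"
  proof
    fix R assume "R \<in> round_generator t"
    then obtain D C where R: "R = D \<inter> sample_event t C" "D \<in> sets (comm t)" "\<forall>i\<in>agents. C i \<in> sets borel"
      unfolding round_generator_def by blast
    have "D \<in> sets (comm (Suc t))" using comm_mono R(2) by (auto simp: subalgebra_def)
    moreover have "sample_event t C \<in> sets (comm (Suc t))"
      using R(3) by (intro sample_event_measurable[OF t]) auto
    ultimately show "R \<in> sets (comm (Suc t))" unfolding R(1) by (rule sets.Int)
  qed
  from sets.sigma_sets_subset[OF this]
  show "sigma_sets (space M) (round_generator t) \<subseteq> sets (comm (Suc t))" by simp
  have old: "D \<in> round_generator t" if "D \<in> sets (comm t)" for D
  proof -
    have "D \<inter> sample_event t (\<lambda>_. UNIV) \<in> round_generator t"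
      using that by (intro round_generatorI) auto
    moreover have "D \<inter> sample_event t (\<lambda>_. UNIV) = D"
      using sets.sets_into_space[OF that] by (auto simp: sample_event_def)
    ultimately show ?thesis by simp
  qed
  have "X -` A \<inter> space M \<in> round_generator t"
    if X: "X \<in> S ` agents \<union> {Y j s | j s. j \<in> agents \<and> 1 \<le> s \<and> s < Suc t}" and A: "A \<in> sets borel" for X A
  proof (cases "X \<in> S ` agents \<union> {Y j s | j s. j \<in> agents \<and> 1 \<le> s \<and> s < t}")
    case True
    then have "X \<in> borel_measurable (comm t)"
      unfolding communication_history_def by (rule measurable_sigma_of)
    from measurable_sets[OF this A] show ?thesis by (intro old) simp
  next
    case False
    with X obtain j where j: "j \<in> agents" "X = Y j t" by (auto simp: less_Suc_eq)
    have "space M \<inter> sample_event t ((\<lambda>_. UNIV)(j := A)) \<in> round_generator t"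
      using A sets.top[of "comm t"] by (intro round_generatorI) auto
    moreover have "space M \<inter> sample_event t ((\<lambda>_. UNIV)(j := A)) = X -` A \<inter> space M"
      using j by (auto simp: sample_event_def)
    ultimately show ?thesis by simp
  qed
  then have "{X -` A \<inter> space M | X A. X \<in> S ` agents \<union> {Y j s | j s. j \<in> agents \<and> 1 \<le> s \<and> s < Suc t} \<and> A \<in> sets borel}
      \<subseteq> round_generator t" by blast
  then show "sets (comm (Suc t)) \<subseteq> sigma_sets (space M) (round_generator t)"
    unfolding communication_history_def sets_sigma_of by (intro sigma_sets_mono')
qed

lemma round_generator_Int_stable: "Int_stable (round_generator t)"
proof (rule Int_stableI)
  fix a b assume "a \<in> round_generator t" "b \<in> round_generator t"
  then obtain D C D' C' where "a = D \<inter> sample_event t C" "b = D' \<inter> sample_event t C'"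
    and m: "D \<in> sets (comm t)" "D' \<in> sets (comm t)" "\<forall>i\<in>agents. C i \<in> sets borel" "\<forall>i\<in>agents. C' i \<in> sets borel"
    unfolding round_generator_def by blast
  then have "a \<inter> b = (D \<inter> D') \<inter> sample_event t (\<lambda>i. C i \<inter> C' i)"
    by (auto simp: sample_event_def)
  moreover have "(D \<inter> D') \<inter> sample_event t (\<lambda>i. C i \<inter> C' i) \<in> round_generator t"
    using m by (intro round_generatorI sets.Int) auto
  ultimately show "a \<inter> b \<in> round_generator t" by simp
qed

text \<open>Induction over the rounds. On a generator \<open>D \<inter> sample_event t C\<close>, the samples of
round \<open>t\<close> are integrated out first, both for the indicator of \<open>\<theta> \<in> A\<close> and for its posterior \<open>q\<close> given the
signals; this leaves a weight \<open>\<pi>\<close> that depends only on the history before round \<open>t\<close>,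
against which the induction hypothesis exchanges the two.\<close>

lemma comm_posterior_eq_signal_posterior:
  assumes A: "A \<in> sets borel"
  shows "AE \<omega> in M. cond_prob_of M (comm t) (state_event A) \<omega> = cond_prob_of M signal_info (state_event A) \<omega>"
proof (induction t)
  case 0
  show ?case by (simp add: comm_early)
next
  case (Suc t)
  define B where "B = state_event A"
  define q where "q = cond_prob_of M signal_info B"
  have B: "B \<in> sets M" unfolding B_def using A by simp
  have q: "integrable M q" "q \<in> borel_measurable signal_info" "q \<in> borel_measurable M"
    unfolding q_def by (auto intro: integrable_cond_prob_of subalgebra_signal B)
  have qt: "q \<in> borel_measurable (comm t)" for t
    by (rule measurable_from_subalg[OF subalgebra_comm_signal q(2)])
  have qh: "q \<in> borel_measurable (history t)"
    by (rule measurable_from_subalg[OF subalgebra_history_comm qt])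
  have indi: "integrable M (indicat_real D)" if "D \<in> sets M" for D
    using that by (simp add: emeasure_eq_measure)
  show ?case
  proof (cases "t = 0")
    case True
    then show ?thesis by (simp add: comm_early)
  next
    case False
    then have t: "1 \<le> t" by simp
    have "AE x in M. real_cond_exp M (comm (Suc t)) (indicator B) x = q x"
    proof (rule real_cond_exp_eqI_generator[OF subalgebra_comm sets_comm_Suc[OF t] round_generator_Int_stable])
      have "space M \<inter> sample_event t (\<lambda>_. UNIV) \<in> round_generator t"
        using sets.top[of "comm t"] by (intro round_generatorI) auto
      then show "space M \<in> round_generator t" by (simp add: sample_event_def Int_def)
      show "integrable M (indicat_real B)" by (rule indi[OF B])
      fix R assume "R \<in> round_generator t"
      then obtain D C where R: "R = D \<inter> sample_event t C" and D: "D \<in> sets (comm t)"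
        and C: "\<And>i. i \<in> agents \<Longrightarrow> C i \<in> sets borel"
        unfolding round_generator_def by blast
      define \<pi> where "\<pi> \<omega> = (\<Prod>i\<in>agents. measure (\<mu> i t \<omega>) (C i))" for \<omega>
      have \<pi>: "\<pi> \<in> borel_measurable (comm t)"
        unfolding \<pi>_def by (rule posterior_product_measurable[OF t C])
      have \<pi>M: "\<pi> \<in> borel_measurable M" by (rule measurable_from_subalg[OF subalgebra_comm \<pi>])
      have DM: "D \<in> sets M" and Dh: "D \<in> sets (history t)"
        using D subalgebra_comm[of t] subalgebra_history_comm[of t] unfolding subalgebra_def by blast+
      have Bh: "B \<in> sets (history t)" unfolding B_def by (rule state_event_history[OF A])
      have D\<pi>: "(\<lambda>x. indicator D x * \<pi> x) \<in> borel_measurable (comm t)"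
        using D \<pi> by (intro borel_measurable_times) auto
      have D\<pi>i: "integrable M (\<lambda>x. indicator D x * \<pi> x)"
      proof (rule integrable_const_bound[of _ 1])
        show "AE x in M. norm (indicator D x * \<pi> x) \<le> 1"
          using posterior_product_le_1[OF t] unfolding \<pi>_def
          by (intro AE_I2) (auto simp: indicator_def abs_of_nonneg prod_nonneg)
        show "(\<lambda>x. indicator D x * \<pi> x) \<in> borel_measurable M"
          by (rule measurable_from_subalg[OF subalgebra_comm D\<pi>])
      qed
      have "(\<integral>x\<in>R. indicat_real B x \<partial>M) = expectation (\<lambda>x. (indicator D x * indicator B x) * indicator (sample_event t C) x)"
        unfolding set_lebesgue_integral_def R
        by (intro Bochner_Integration.integral_cong) (auto simp: indicator_def)
      also have "\<dots> = expectation (\<lambda>x. (indicator D x * indicator B x) * \<pi> x)"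
        unfolding \<pi>_def
      proof (rule integral_sample_event[OF t C])
        show "(\<lambda>x. indicator D x * indicat_real B x) \<in> borel_measurable (history t)"
          using Dh Bh by (intro borel_measurable_times) auto
        show "integrable M (\<lambda>x. indicator D x * indicat_real B x)"
          by (rule integrable_real_mult_indicator[OF B indi[OF DM]])
      qed
      also have "\<dots> = expectation (\<lambda>x. (indicator D x * \<pi> x) * indicator B x)"
        by (simp add: mult_ac)
      also have "\<dots> = expectation (\<lambda>x. (indicator D x * \<pi> x) * cond_prob_of M (comm t) B x)"
        by (rule integral_mult_cond_prob_of(2)[symmetric, OF subalgebra_comm B D\<pi> D\<pi>i])
      also have "\<dots> = expectation (\<lambda>x. (indicator D x * \<pi> x) * q x)"
        using Suc.IH D\<pi>i q(3) unfolding B_def[symmetric] q_def[symmetric]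
        by (intro integral_cong_AE_mult) auto
      also have "\<dots> = expectation (\<lambda>x. (indicator D x * q x) * \<pi> x)"
        by (simp add: mult_ac)
      also have "\<dots> = expectation (\<lambda>x. (indicator D x * q x) * indicator (sample_event t C) x)"
        unfolding \<pi>_def
      proof (rule integral_sample_event[OF t C, symmetric])
        show "(\<lambda>x. indicator D x * q x) \<in> borel_measurable (history t)"
          using Dh qh by (intro borel_measurable_times) auto
        show "integrable M (\<lambda>x. indicator D x * q x)"
          using integrable_mult_indicator[OF DM q(1)] by simp
      qed
      also have "\<dots> = (\<integral>x\<in>R. q x \<partial>M)"
        unfolding set_lebesgue_integral_def R
        by (intro Bochner_Integration.integral_cong) (auto simp: indicator_def)
      finally show "(\<integral>x\<in>R. indicat_real B x \<partial>M) = (\<integral>x\<in>R. q x \<partial>M)" .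
    qed (rule q qt)+
    then show ?thesis by (simp add: cond_prob_of_def B_def q_def)
  qed
qed

text \<open>Agents learn about the state only through the signals: the limiting information of agent \<open>i\<close> is
generated by parts of communication histories, and for these \<open>q\<close> is the posterior.\<close>

lemma cond_exp_signal_posterior:
  assumes i: "i \<in> agents" and A: "A \<in> sets borel"
  shows "AE \<omega> in M. real_cond_exp M (info_limit i) (cond_prob_of M signal_info (state_event A)) \<omega> =
    cond_prob_of M (info_limit i) (state_event A) \<omega>"
proof -
  define B where "B = state_event A"
  have B: "B \<in> sets M" unfolding B_def using A by simp
  show ?thesis unfolding B_def[symmetric]
  proof (rule real_cond_exp_eqI_generator[OF subalgebra_info_limit[OF i] sets_info_limit info_union_Int_stable])
    show "space M \<in> (\<Union>t. sets (info i t))" using sets.top[of "info i 0"] by auto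
    fix D assume "D \<in> (\<Union>t. sets (info i t))"
    then obtain t where D: "D \<in> sets (info i t)" by blast
    have Dc: "D \<in> sets (comm t)" "D \<in> sets (info_limit i)" and DM: "D \<in> sets M"
      using D subalgebra_comm_info[OF i, of t] subalgebra_info_limit_info[of i t] subalgebra_info[OF i, of t]
      by (auto simp: subalgebra_def)
    have indi: "integrable M (indicat_real D)" using DM by (simp add: emeasure_eq_measure)
    have "(\<integral>x\<in>D. cond_prob_of M signal_info B x \<partial>M) = expectation (\<lambda>x. indicator D x * cond_prob_of M (comm t) B x)"
      unfolding set_lebesgue_integral_def real_scaleR_def
      using DM comm_posterior_eq_signal_posterior[OF A, of t] unfolding B_def[symmetric]
      by (intro integral_cong_AE_mult) (auto elim: eventually_mono)
    also have "\<dots> = expectation (\<lambda>x. indicator D x * indicator B x)"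
      using Dc by (intro integral_mult_cond_prob_of(2)[OF subalgebra_comm B _ indi]) auto
    also have "\<dots> = expectation (\<lambda>x. indicator D x * cond_prob_of M (info_limit i) B x)"
      using Dc by (intro integral_mult_cond_prob_of(2)[symmetric, OF subalgebra_info_limit[OF i] B _ indi]) auto
    finally show "(\<integral>x\<in>D. cond_prob_of M signal_info B x \<partial>M) = (\<integral>x\<in>D. cond_prob_of M (info_limit i) B x \<partial>M)"
      by (simp add: set_lebesgue_integral_def)
  qed (auto intro: integrable_cond_prob_of subalgebra_signal subalgebra_info_limit i B)
qed

section \<open>Connected agents agree in the limit\<close>

lemma Levy_info:
  assumes i: "i \<in> agents" and A: "A \<in> sets borel"
  shows "AE \<omega> in M. (\<lambda>t. cond_prob_of M (info i t) (state_event A) \<omega>)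
    \<longlonglongrightarrow> cond_prob_of M (info_limit i) (state_event A) \<omega>"
  unfolding cond_prob_of_def info_limit_eq
proof (rule Levy_upward)
  show "integrable M (indicat_real (state_event A))"
    using state_event[OF A] by (simp add: emeasure_eq_measure)
qed (auto intro: subalgebra_info i info_mono[THEN subsetD])

text \<open>Agent \<open>i\<close> observes the sample that \<open>j\<close> draws at time \<open>t\<close>. Testing the
error \<open>1\<^sub>A - p\<^sub>i(t)\<close> against that sample is the same as testing it against the posterior of \<open>j\<close>, as the
error is determined by the past. But in the limit agent \<open>i\<close> knows the sample, and the error is orthogonal
to what \<open>i\<close> knows. Letting \<open>t\<close> grow, the limiting error of \<open>i\<close> is orthogonal to the limiting
posterior of \<open>j\<close>.\<close>

lemma integral_posterior_neighbour:
  assumes ij: "(i, j) \<in> E" and A: "A \<in> sets borel"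
  defines "p \<equiv> \<lambda>i. cond_prob_of M (info_limit i) (state_event A)"
  shows "expectation (\<lambda>\<omega>. p i \<omega> * p j \<omega>) = expectation (\<lambda>\<omega>. p j \<omega> * indicator (state_event A) \<omega>)"
proof -
  define B where "B = state_event A"
  have B: "B \<in> sets M" unfolding B_def using A by simp
  have i: "i \<in> agents" and j: "j \<in> agents" using edges[OF ij] by auto
  define r where "r k t = cond_prob_of M (info k t) B" for k t
  have p_def': "p k = cond_prob_of M (info_limit k) B" for k by (simp add: p_def B_def)
  have [measurable]: "B \<in> sets M" "\<And>k. p k \<in> borel_measurable M" "\<And>k t. r k t \<in> borel_measurable M"
    using B by (simp_all add: p_def' r_def)
  have p01: "AE x in M. 0 \<le> p k x \<and> p k x \<le> 1" if "k \<in> agents" for k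
    using cond_prob_of_bounds[OF subalgebra_info_limit[OF that] B] unfolding p_def' by eventually_elim simp
  have r01: "AE x in M. \<forall>t. 0 \<le> r k t x \<and> r k t x \<le> 1" if "k \<in> agents" for k
    unfolding AE_all_countable r_def
    using cond_prob_of_bounds[OF subalgebra_info[OF that] B] by (auto elim: eventually_elim2)
  have lim: "AE x in M. (\<lambda>t. r k t x) \<longlonglongrightarrow> p k x" if "k \<in> agents" for k
    using Levy_info[OF that A] by (simp add: r_def p_def B_def)
  define y where "y t = indicat_real (Y j t -` A \<inter> space M)" for t
  have ev: "Y j t -` A \<inter> space M \<in> sets (info_limit i)" if "1 \<le> t" for t
    using measurable_sets[OF sample_measurable_info_limit[OF ij that] A] by simp
  have evM: "Y j t -` A \<inter> space M \<in> sets M" if "1 \<le> t" for t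
    using ev[OF that] subalgebra_info_limit[OF i] by (auto simp: subalgebra_def)
  have y[measurable]: "y t \<in> borel_measurable M" if "1 \<le> t" for t
    unfolding y_def using evM[OF that] by simp
  have yi: "integrable M (y t)" if "1 \<le> t" for t
    unfolding y_def using evM[OF that] by (simp add: emeasure_eq_measure)
  \<comment> \<open>On the left the event is replaced by its limiting posterior \<open>p i\<close>, because \<open>i\<close> eventually sees the sample; on the right the sample is replaced by the posterior of \<open>j\<close>, because the error belongs to the past.\<close>
  have step: "expectation (\<lambda>x. (p i x - r i t x) * y t x) = expectation (\<lambda>x. (indicator B x - r i t x) * r j t x)"
    if t: "1 \<le> t" for t
  proof -
    have int: "integrable M (\<lambda>x. y t x * p i x)"
        "expectation (\<lambda>x. y t x * p i x) = expectation (\<lambda>x. y t x * indicator B x)"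
      unfolding p_def' using yi[OF t] ev[OF t]
      by (auto intro!: integral_mult_cond_prob_of[OF subalgebra_info_limit[OF i] B] simp: y_def)
    have int2: "integrable M (\<lambda>x. y t x * r i t x)"
      using integrable_mult_indicator[OF evM[OF t] integrable_cond_prob_of[OF subalgebra_info[OF i] B, of t]]
      by (simp add: y_def r_def)
    have int3: "integrable M (\<lambda>x. y t x * indicator B x)"
      by (rule integrable_real_mult_indicator[OF B yi[OF t]])
    \<comment> \<open>Only the sample of \<open>j\<close> is constrained, so the product of posterior probabilities reduces to one factor.\<close>
    define C where "C = (\<lambda>_. UNIV)(j := A)"
    have C: "C k \<in> sets borel" for k using A by (simp add: C_def)
    have yC: "y t = indicator (sample_event t C)"
      unfolding y_def sample_event_def C_def using j by (intro arg_cong[of _ _ indicator]) auto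
    have Z: "(\<lambda>x. indicator B x - r i t x) \<in> borel_measurable (history t)"
    proof (intro borel_measurable_diff borel_measurable_indicator)
      show "B \<in> sets (history t)" unfolding B_def by (rule state_event_history[OF A])
      show "r i t \<in> borel_measurable (history t)" unfolding r_def
        by (intro measurable_from_subalg[OF subalgebra_history_comm]
          measurable_from_subalg[OF subalgebra_comm_info[OF i]] cond_prob_of_measurable)
    qed
    have Zi: "integrable M (\<lambda>x. indicator B x - r i t x)"
      using integrable_cond_prob_of[OF subalgebra_info[OF i] B, of t] B
      unfolding r_def by (intro Bochner_Integration.integrable_diff) (auto simp: emeasure_eq_measure)
    have "expectation (\<lambda>x. (p i x - r i t x) * y t x) = expectation (\<lambda>x. y t x * p i x - y t x * r i t x)"
      by (simp add: algebra_simps)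
    also have "\<dots> = expectation (\<lambda>x. y t x * indicator B x - y t x * r i t x)"
      using int int2 int3 by simp
    also have "\<dots> = expectation (\<lambda>x. (indicator B x - r i t x) * indicator (sample_event t C) x)"
      by (simp add: algebra_simps yC)
    also have "\<dots> = expectation (\<lambda>x. (indicator B x - r i t x) * (\<Prod>k\<in>agents. measure (\<mu> k t x) (C k)))"
      by (rule integral_sample_event[OF t C Z Zi])
    also have "\<dots> = expectation (\<lambda>x. (indicator B x - r i t x) * r j t x)"
    proof (rule integral_cong_AE_mult)
      show "AE x in M. (\<Prod>k\<in>agents. measure (\<mu> k t x) (C k)) = r j t x"
        using posterior_AE[OF j t A] AE_space
      proof eventually_elim
        case (elim x)
        have "measure (\<mu> k t x) (C k) = (if k = j then measure (\<mu> j t x) A else 1)" if "k \<in> agents" for k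
        proof (cases "k = j")
          case False
          interpret K: prob_space "\<mu> k t x" by (rule posterior_space[OF that t elim(2)])
          have "space (\<mu> k t x) = UNIV"
            using posterior_space(2)[OF that t elim(2)] by (metis sets_eq_imp_space_eq space_borel)
          then show ?thesis using False K.prob_space by (simp add: C_def)
        qed (simp add: C_def)
        then have "(\<Prod>k\<in>agents. measure (\<mu> k t x) (C k)) = measure (\<mu> j t x) A"
          using j by (simp add: prod.delta)
        then show ?case using elim(1) by (simp add: r_def B_def)
      qed
      show "(\<lambda>x. \<Prod>k\<in>agents. measure (\<mu> k t x) (C k)) \<in> borel_measurable M"
        by (rule measurable_from_subalg[OF subalgebra_comm posterior_product_measurable[OF t C]])
    qed (use B in measurable)
    finally show ?thesis .
  qed
  have "(\<lambda>t. expectation (\<lambda>x. (p i x - r i (Suc t) x) * y (Suc t) x)) \<longlonglongrightarrow> expectation (\<lambda>x. 0)"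
  proof (rule integral_dominated_convergence[where w = "\<lambda>_. 1"])
    show "AE x in M. (\<lambda>t. (p i x - r i (Suc t) x) * y (Suc t) x) \<longlonglongrightarrow> 0"
      using lim[OF i]
    proof eventually_elim
      case (elim x)
      from LIMSEQ_Suc[OF elim] have "(\<lambda>t. p i x - r i (Suc t) x) \<longlonglongrightarrow> 0"
        using tendsto_diff[OF tendsto_const[of "p i x"]] by force
      then show ?case
        by (rule Lim_null_comparison[rotated, OF tendsto_rabs_zero]) (auto simp: y_def indicator_def)
    qed
    show "AE x in M. norm ((p i x - r i (Suc t) x) * y (Suc t) x) \<le> 1" for t
      using p01[OF i] r01[OF i]
    proof eventually_elim
      case (elim x)
      then have "0 \<le> r i (Suc t) x" "r i (Suc t) x \<le> 1" by blast+
      with elim(1) show ?case by (auto simp: y_def indicator_def abs_le_iff)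
    qed
  qed (use y in \<open>auto intro!: borel_measurable_times borel_measurable_diff\<close>)
  then have lim1: "(\<lambda>t. expectation (\<lambda>x. (indicator B x - r i (Suc t) x) * r j (Suc t) x)) \<longlonglongrightarrow> 0"
    by (simp add: step)
  have lim2: "(\<lambda>t. expectation (\<lambda>x. (indicator B x - r i (Suc t) x) * r j (Suc t) x))
      \<longlonglongrightarrow> expectation (\<lambda>x. (indicator B x - p i x) * p j x)"
  proof (rule integral_dominated_convergence[where w = "\<lambda>_. 1"])
    show "AE x in M. (\<lambda>t. (indicator B x - r i (Suc t) x) * r j (Suc t) x) \<longlonglongrightarrow> (indicator B x - p i x) * p j x"
      using lim[OF i] lim[OF j]
    proof eventually_elim
      case (elim x)
      show ?case by (intro tendsto_intros LIMSEQ_Suc elim)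
    qed
    show "AE x in M. norm ((indicator B x - r i (Suc t) x) * r j (Suc t) x) \<le> 1" for t
      using r01[OF i] r01[OF j]
    proof eventually_elim
      case (elim x)
      then have "0 \<le> r i (Suc t) x" "r i (Suc t) x \<le> 1" "0 \<le> r j (Suc t) x" "r j (Suc t) x \<le> 1" by blast+
      then show ?case unfolding norm_mult by (intro mult_le_one) (auto simp: indicator_def)
    qed
  qed auto
  have "expectation (\<lambda>x. (indicator B x - p i x) * p j x) = 0"
    by (rule LIMSEQ_unique[OF lim2 lim1])
  moreover have "integrable M (\<lambda>x. p j x * indicator B x)"
    unfolding p_def' by (intro integrable_real_mult_indicator B integrable_cond_prob_of subalgebra_info_limit j)
  moreover have "integrable M (\<lambda>x. p i x * p j x)"
  proof (rule integrable_const_bound[of _ 1])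
    show "AE x in M. norm (p i x * p j x) \<le> 1"
      using p01[OF i] p01[OF j] by eventually_elim (auto simp: abs_mult intro: mult_le_one)
  qed auto
  ultimately have "expectation (\<lambda>x. p j x * indicator B x) - expectation (\<lambda>x. p i x * p j x) = 0"
    by (subst Bochner_Integration.integral_diff[symmetric]) (auto simp: algebra_simps)
  then show ?thesis by (simp add: B_def)
qed

text \<open>The product \<open>p\<^sub>i p\<^sub>j\<close> has the same mean as \<open>p\<^sub>j\<^sup>2\<close> and, since edges go both ways, as \<open>p\<^sub>i\<^sup>2\<close>; so the
two posteriors have \<open>L\<^sup>2\<close>-distance zero.\<close>

lemma neighbours_agree:
  assumes ij: "(i, j) \<in> E" and A: "A \<in> sets borel"
  shows "AE \<omega> in M. cond_prob_of M (info_limit i) (state_event A) \<omega> =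
    cond_prob_of M (info_limit j) (state_event A) \<omega>"
proof -
  define B where "B = state_event A"
  have B: "B \<in> sets M" unfolding B_def using A by simp
  define p where "p k = cond_prob_of M (info_limit k) B" for k
  have ji: "(j, i) \<in> E" by (rule edge_sym[OF ij])
  have i: "i \<in> agents" and j: "j \<in> agents" using edges[OF ij] by auto
  have pm: "p k \<in> borel_measurable M" "p k \<in> borel_measurable (info_limit k)" for k by (simp_all add: p_def)
  have pint: "integrable M (p k)" if "k \<in> agents" for k
    unfolding p_def by (rule integrable_cond_prob_of[OF subalgebra_info_limit[OF that] B])
  have p01: "AE x in M. 0 \<le> p k x \<and> p k x \<le> 1" if "k \<in> agents" for k
    using cond_prob_of_bounds[OF subalgebra_info_limit[OF that] B] unfolding p_def by eventually_elim simp
  have prod_int: "integrable M (\<lambda>x. p k x * p l x)" if "k \<in> agents" "l \<in> agents" for k l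
  proof (rule integrable_const_bound[of _ 1])
    show "AE x in M. norm (p k x * p l x) \<le> 1"
      using p01[OF that(1)] p01[OF that(2)] by eventually_elim (auto simp: abs_mult intro: mult_le_one)
  qed (use pm in measurable)
  have sq: "expectation (\<lambda>x. p k x * p k x) = expectation (\<lambda>x. p k x * indicator B x)" if "k \<in> agents" for k
    using integral_mult_cond_prob_of(2)[OF subalgebra_info_limit[OF that] B pm(2) pint[OF that]]
    by (simp add: p_def)
  have cross: "expectation (\<lambda>x. p i x * p j x) = expectation (\<lambda>x. p j x * p j x)"
      "expectation (\<lambda>x. p i x * p j x) = expectation (\<lambda>x. p i x * p i x)"
    using integral_posterior_neighbour[OF ij A] integral_posterior_neighbour[OF ji A] sq[OF i] sq[OF j]
    by (simp_all add: p_def B_def mult.commute)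
  have "(\<lambda>x. (p i x - p j x)\<^sup>2) = (\<lambda>x. p i x * p i x + p j x * p j x - (p i x * p j x + p i x * p j x))"
    by (simp add: fun_eq_iff power2_eq_square algebra_simps)
  then have int: "integrable M (\<lambda>x. (p i x - p j x)\<^sup>2)" "expectation (\<lambda>x. (p i x - p j x)\<^sup>2) = 0"
    using prod_int[OF i i] prod_int[OF j j] prod_int[OF i j] cross by simp_all
  then have "AE x in M. (p i x - p j x)\<^sup>2 = 0"
    by (subst integral_nonneg_eq_0_iff_AE[symmetric]) auto
  then show ?thesis unfolding p_def B_def by (auto elim: eventually_mono)
qed

lemma connected_agree:
  assumes "(i, j) \<in> E\<^sup>*" and A: "A \<in> sets borel"
  shows "AE \<omega> in M. cond_prob_of M (info_limit i) (state_event A) \<omega> =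
    cond_prob_of M (info_limit j) (state_event A) \<omega>"
  using assms(1)
proof (induction rule: rtrancl_induct)
  case (step j k)
  from step.IH neighbours_agree[OF step.hyps(2) A] show ?case by eventually_elim simp
qed simp

end

section \<open>Log-likelihood ratios under the Bayes law\<close>

text \<open>The integrand \<open>abs_log_ratio\<close> is infinite as soon as one of the probabilities is not positive, so finiteness of its integral
excludes that almost surely.\<close>

lemma integrable_log_ratio:
  assumes a[measurable]: "a \<in> borel_measurable M" and b[measurable]: "b \<in> borel_measurable M"
    and fin: "(\<integral>\<^sup>+ x. abs_log_ratio (a x) (b x) \<partial>M) < \<infinity>"
  shows "AE x in M. 0 < a x \<and> 0 < b x" "integrable M (\<lambda>x. ln (a x / b x))"
proof -
  have m: "(\<lambda>x. abs_log_ratio (a x) (b x)) \<in> borel_measurable M"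
    unfolding abs_log_ratio_def by measurable
  have "AE x in M. abs_log_ratio (a x) (b x) \<noteq> \<infinity>"
    using nn_integral_PInf_AE[OF m] fin by auto
  then show pos: "AE x in M. 0 < a x \<and> 0 < b x"
    by eventually_elim (auto simp: abs_log_ratio_def split: if_splits)
  have "(\<integral>\<^sup>+ x. ennreal (norm (ln (a x / b x))) \<partial>M) = (\<integral>\<^sup>+ x. abs_log_ratio (a x) (b x) \<partial>M)"
    using pos by (intro nn_integral_cong_AE) (auto elim!: eventually_mono simp: abs_log_ratio_def)
  with fin show "integrable M (\<lambda>x. ln (a x / b x))"
    by (intro integrableI_bounded) auto
qed

context sampling_model
begin

lemma state_event_compl: "state_event (- A) = space M - state_event A"
  by (auto simp: state_event_def)

text \<open>The Bayes law for \<open>A\<close> and for its complement involves the same normalising factor, which cancels in the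
odds. The logarithm then separates the signals.\<close>

lemma bayes_logit:
  assumes bayes: "bayes_law M n \<theta> S"
    and fin: "\<And>i. i \<in> agents \<Longrightarrow> finite_information M \<theta> (S i)"
    and A: "A \<in> sets borel" and P: "prob (state_event A) \<in> {0<..<1}"
  defines "q \<equiv> cond_prob_of M signal_info (state_event A)"
    and "L \<equiv> \<lambda>i \<omega>. ln (cond_prob_of M (sigma_of M {S i}) (state_event A) \<omega> /
      cond_prob_of M (sigma_of M {S i}) (state_event (- A)) \<omega>)"
  shows "AE \<omega> in M. 0 < q \<omega> \<and> q \<omega> < 1 \<and>
      ln (q \<omega>) - ln (1 - q \<omega>) = (\<Sum>i\<in>agents. L i \<omega>) +
        real (n - 1) * (ln (prob (state_event (- A))) - ln (prob (state_event A)))"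
    and "i \<in> agents \<Longrightarrow> integrable M (L i)"
proof -
  define B where "B = state_event A"
  define B' where "B' = state_event (- A)"
  have A': "- A \<in> sets borel" using A by auto
  have B: "B \<in> sets M" "B' \<in> sets M" "B' = space M - B"
    using A A' by (simp_all add: B_def B'_def state_event_compl)
  have PB: "0 < prob B" "0 < prob B'" using P B by (auto simp: B_def[symmetric] prob_compl)
  have P': "prob (state_event (- A)) \<in> {0<..<1}"
    using P B by (auto simp: B_def B'_def prob_compl)
  define a where "a i = cond_prob_of M (sigma_of M {S i}) B" for i
  define b where "b i = cond_prob_of M (sigma_of M {S i}) B'" for i
  have ab: "(\<integral>\<^sup>+ \<omega>. abs_log_ratio (a i \<omega>) (b i \<omega>) \<partial>M) < \<infinity>" if "i \<in> agents" for i
    using fin[OF that] A P unfolding finite_information_def a_def b_def B_def B'_def state_event_def by blast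
  have abm: "a i \<in> borel_measurable M" "b i \<in> borel_measurable M" for i
    by (simp_all add: a_def b_def)
  show "integrable M (L i)" if "i \<in> agents" for i
    using integrable_log_ratio(2)[OF abm ab[OF that]] by (simp add: L_def a_def b_def B_def B'_def)
  have pos: "AE x in M. \<forall>i\<in>agents. 0 < a i x \<and> 0 < b i x"
    using integrable_log_ratio(1)[OF abm ab] by (intro AE_finite_allI) auto
  from bayes obtain f :: "(nat \<Rightarrow> real ^ 'd) \<Rightarrow> real" where f: "\<And>x. x \<in> agents \<rightarrow>\<^sub>E UNIV \<Longrightarrow> 0 < f x"
    and f_eq: "\<And>A. A \<in> sets borel \<Longrightarrow> prob (state_event A) \<in> {0<..<1} \<Longrightarrow>
      AE \<omega> in M. cond_prob_of M signal_info (state_event A) \<omega> =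
        (\<Prod>i\<in>agents. cond_prob_of M (sigma_of M {S i}) (state_event A) \<omega>)
        / prob (state_event A) ^ (n - 1) * f (\<lambda>i\<in>agents. S i \<omega>)"
    unfolding bayes_law_def agents_def state_event_def by blast
  have "AE \<omega> in M. cond_prob_of M signal_info B' \<omega> = 1 - q \<omega>"
    unfolding q_def B(3) B_def[symmetric] by (rule cond_prob_of_compl[OF subalgebra_signal B(1)])
  with f_eq[OF A P] f_eq[OF A' P'] pos
  show "AE \<omega> in M. 0 < q \<omega> \<and> q \<omega> < 1 \<and>
      ln (q \<omega>) - ln (1 - q \<omega>) = (\<Sum>i\<in>agents. L i \<omega>) +
        real (n - 1) * (ln (prob (state_event (- A))) - ln (prob (state_event A)))"
  proof eventually_elim
    case (elim x)
    define F where "F = f (\<lambda>i\<in>agents. S i x)"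
    have F: "0 < F" unfolding F_def by (rule f) auto
    have q1: "q x = (\<Prod>i\<in>agents. a i x) / prob B ^ (n - 1) * F"
      using elim(1) by (simp add: q_def a_def B_def F_def)
    have q2: "1 - q x = (\<Prod>i\<in>agents. b i x) / prob B' ^ (n - 1) * F"
      using elim(2,4) by (simp add: b_def B'_def F_def)
    have pa: "0 < (\<Prod>i\<in>agents. a i x)" "0 < (\<Prod>i\<in>agents. b i x)" using elim(3) by (auto intro: prod_pos)
    have ln_factor: "ln ((\<Prod>i\<in>agents. c i) / r ^ (n - 1) * F) = (\<Sum>i\<in>agents. ln (c i)) - real (n - 1) * ln r + ln F"
      if "\<And>i. i \<in> agents \<Longrightarrow> 0 < c i" "0 < r" for c :: "nat \<Rightarrow> real" and r
    proof -
      have "0 < (\<Prod>i\<in>agents. c i)" "0 < r ^ (n - 1)" using that by (auto intro: prod_pos)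
      then have "ln ((\<Prod>i\<in>agents. c i) / r ^ (n - 1) * F) = ln (\<Prod>i\<in>agents. c i) - ln (r ^ (n - 1)) + ln F"
        using F by (subst ln_mult_pos) (auto simp: ln_divide_pos)
      moreover have "ln (\<Prod>i\<in>agents. c i) = (\<Sum>i\<in>agents. ln (c i))"
        by (rule ln_prod) (auto dest: that(1))
      ultimately show ?thesis using that(2) by (simp add: ln_realpow)
    qed
    have "ln (q x) = (\<Sum>i\<in>agents. ln (a i x)) - real (n - 1) * ln (prob B) + ln F"
      unfolding q1 using PB elim(3) by (intro ln_factor) auto
    moreover have "ln (1 - q x) = (\<Sum>i\<in>agents. ln (b i x)) - real (n - 1) * ln (prob B') + ln F"
      unfolding q2 using PB elim(3) by (intro ln_factor) auto
    moreover have "(\<Sum>i\<in>agents. L i x) = (\<Sum>i\<in>agents. ln (a i x)) - (\<Sum>i\<in>agents. ln (b i x))"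
      unfolding sum_subtractf[symmetric] using elim(3)
      by (intro sum.cong) (auto simp: L_def a_def b_def B_def B'_def ln_div)
    moreover have "0 < q x" unfolding q1 using pa F PB by simp
    moreover have "0 < 1 - q x" unfolding q2 using pa F PB by simp
    ultimately show ?case by (simp add: B_def B'_def algebra_simps)
  qed
qed

section \<open>The limiting posterior\<close>

text \<open>The agents are the observers of \<open>common_posterior_eq_full_posterior\<close>: connectedness makes them agree, the
Bayes law separates the log-odds, and each term is a function of a signal that its agent knows.\<close>

lemma limit_posterior_eq_full_posterior:
  assumes conn: "connected_graph agents E" and bayes: "bayes_law M n \<theta> S"
    and fin: "\<And>i. i \<in> agents \<Longrightarrow> finite_information M \<theta> (S i)"
    and k: "k \<in> agents" and A: "A \<in> sets borel"
  shows "AE \<omega> in M. cond_prob_of M (info_limit k) (state_event A) \<omega> =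
    cond_prob_of M signal_info (state_event A) \<omega>"
proof -
  note B = state_event[OF A]
  consider "prob (state_event A) \<in> {0<..<1}" | "prob (state_event A) = 0" | "prob (state_event A) = 1"
    using prob_le_1[of "state_event A"] measure_nonneg[of M "state_event A"]
    by (auto simp: less_le)
  then show ?thesis
  proof cases
    case 1
    define q where "q = cond_prob_of M signal_info (state_event A)"
    define L where "L i \<omega> = ln (cond_prob_of M (sigma_of M {S i}) (state_event A) \<omega> /
      cond_prob_of M (sigma_of M {S i}) (state_event (- A)) \<omega>)" for i \<omega>
    have logit: "AE \<omega> in M. 0 < q \<omega> \<and> q \<omega> < 1 \<and> ln (q \<omega>) - ln (1 - q \<omega>) = (\<Sum>i\<in>agents. L i \<omega>) +
        real (n - 1) * (ln (prob (state_event (- A))) - ln (prob (state_event A)))"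
      unfolding q_def L_def by (rule bayes_logit(1)[OF bayes fin A 1])
    show ?thesis unfolding q_def[symmetric]
    proof (rule common_posterior_eq_full_posterior[where I = agents and H = info_limit and L = L and
          p = "\<lambda>i. cond_prob_of M (info_limit i) (state_event A)"])
      show "AE x in M. ln (q x) - ln (1 - q x) = (\<Sum>i\<in>agents. L i x) +
        real (n - 1) * (ln (prob (state_event (- A))) - ln (prob (state_event A)))"
        "AE x in M. 0 < q x" "AE x in M. q x < 1"
        using logit by (auto elim: eventually_mono)
      show "integrable M (L i)" if "i \<in> agents" for i
        using bayes_logit(2)[OF bayes fin A 1 that] by (simp add: L_def[abs_def])
      show "integrable M q"
        unfolding q_def by (rule integrable_cond_prob_of[OF subalgebra_signal B])
      show "AE x in M. real_cond_exp M (info_limit i) q x = cond_prob_of M (info_limit i) (state_event A) x"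
        if "i \<in> agents" for i
        unfolding q_def by (rule cond_exp_signal_posterior[OF that A])
      show "AE x in M. cond_prob_of M (info_limit i) (state_event A) x = cond_prob_of M (info_limit k) (state_event A) x"
        if "i \<in> agents" for i
        using conn that k by (intro connected_agree A) (auto simp: connected_graph_def)
      show "L i \<in> borel_measurable (info_limit i)" if "i \<in> agents" for i
      proof -
        have "cond_prob_of M (sigma_of M {S i}) D \<in> borel_measurable (info_limit i)" for D
          by (intro measurable_from_subalg[OF subalgebra_info_limit_info[of i 0]]
            measurable_from_subalg[OF subalgebra_info_signal[OF that]] cond_prob_of_measurable)
        then show ?thesis unfolding L_def[abs_def] by measurable
      qed
    qed (simp_all add: k subalgebra_info_limit)
  next
    case 2
    from cond_prob_of_trivial(1)[OF subalgebra_info_limit[OF k] B 2]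
      cond_prob_of_trivial(1)[OF subalgebra_signal B 2]
    show ?thesis by eventually_elim simp
  next
    case 3
    from cond_prob_of_trivial(2)[OF subalgebra_info_limit[OF k] B 3]
      cond_prob_of_trivial(2)[OF subalgebra_signal B 3]
    show ?thesis by eventually_elim simp
  qed
qed

end

theorem theorem2p4:
  fixes n :: nat
    and E :: "nat rel"
    and \<nu> :: "(real ^ 'd) measure"
    and P :: "nat \<Rightarrow> real ^ 'd \<Rightarrow> (real ^ 'd) measure"
    and M :: "'w measure"
    and \<theta> :: "'w \<Rightarrow> real ^ 'd"
    and S :: "nat \<Rightarrow> 'w \<Rightarrow> real ^ 'd"
    and Y :: "nat \<Rightarrow> nat \<Rightarrow> 'w \<Rightarrow> real ^ 'd"
    and \<mu> :: "nat \<Rightarrow> nat \<Rightarrow> 'w \<Rightarrow> (real ^ 'd) measure"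
    and \<mu>_lim :: "nat \<Rightarrow> 'w \<Rightarrow> (real ^ 'd) measure"
    and \<mu>_all :: "'w \<Rightarrow> (real ^ 'd) measure"
  assumes model: "sampling_model n E \<nu> P M \<theta> S Y \<mu>"
    and conn: "connected_graph {1..n} E"
    and bayes: "bayes_law M n \<theta> S"
    and info: "\<And>i. i \<in> {1..n} \<Longrightarrow> finite_information M \<theta> (S i)"
    and lim_law: "\<And>i. i \<in> {1..n} \<Longrightarrow>
      is_cond_law M (agent_info_limit M E S Y i) borel \<theta> (\<mu>_lim i)"
    and all_law: "is_cond_law M (sigma_of M (S ` {1..n})) borel \<theta> \<mu>_all"
  shows "\<forall>i\<in>{1..n}.
    (AE \<omega> in M. weak_limit (\<lambda>t. \<mu> i t \<omega>) (\<mu>_lim i \<omega>)) \<and>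
    (AE \<omega> in M. \<mu>_lim i \<omega> = \<mu>_all \<omega>)"
proof -
  interpret sampling_model n E \<nu> P M \<theta> S Y \<mu> by (rule model)
  obtain \<B> :: "(real ^ 'd) set set" where \<B>: "countable \<B>" "topological_basis \<B>"
    using ex_countable_basis by blast
  \<comment> \<open>The countable family of test sets on whose unions both claims can be checked simultaneously outside one null set.\<close>
  define \<F> where "\<F> = {F. finite F \<and> F \<subseteq> \<B>}"
  have \<F>: "countable \<F>" unfolding \<F>_def by (rule countable_Collect_finite_subset[OF \<B>(1)])
  have borel: "\<Union>F \<in> sets borel" if "F \<in> \<F>" for F
    using that topological_basis_open[OF \<B>(2)] unfolding \<F>_def by (intro borel_open open_Union) auto
  show ?thesis
  proof (intro ballI conjI)
    fix i assume "i \<in> {1..n}"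
    then have i: "i \<in> agents" by (simp add: agents_def)
    note lim = is_cond_law_measure[OF lim_law[OF \<open>i \<in> {1..n}\<close>]]
    note all = is_cond_law_measure[OF all_law]
    have "AE \<omega> in M. \<forall>F\<in>\<F>. (\<lambda>t. measure (\<mu> i (Suc t) \<omega>) (\<Union>F)) \<longlonglongrightarrow> measure (\<mu>_lim i \<omega>) (\<Union>F)"
    proof (subst AE_ball_countable[OF \<F>], intro ballI)
      fix F assume F: "F \<in> \<F>"
      have "AE \<omega> in M. \<forall>t. measure (\<mu> i (Suc t) \<omega>) (\<Union>F) = cond_prob_of M (info i (Suc t)) (state_event (\<Union>F)) \<omega>"
        unfolding AE_all_countable using posterior_AE[OF i _ borel[OF F]] by simp
      with Levy_info[OF i borel[OF F]] lim(1)[OF borel[OF F]]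
      show "AE \<omega> in M. (\<lambda>t. measure (\<mu> i (Suc t) \<omega>) (\<Union>F)) \<longlonglongrightarrow> measure (\<mu>_lim i \<omega>) (\<Union>F)"
      proof eventually_elim
        case (elim \<omega>)
        show ?case using LIMSEQ_Suc[OF elim(1)] elim(2,3) by (simp add: state_event_def)
      qed
    qed
    then show "AE \<omega> in M. weak_limit (\<lambda>t. \<mu> i t \<omega>) (\<mu>_lim i \<omega>)"
      using AE_space
    proof eventually_elim
      case (elim \<omega>)
      \<comment> \<open>Only the posteriors at times from \<open>1\<close> on are specified by the model, hence the shift.\<close>
      have "weak_limit (\<lambda>t. \<mu> i (Suc t) \<omega>) (\<mu>_lim i \<omega>)"
      proof (rule weak_limit_finite_unions_of_basis[OF _ _ _ _ \<B>])
        show "prob_space (\<mu> i (Suc t) \<omega>)" "sets (\<mu> i (Suc t) \<omega>) = sets borel" for t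
          using posterior_space[OF i _ elim(2)] by auto
        show "prob_space (\<mu>_lim i \<omega>)" "sets (\<mu>_lim i \<omega>) = sets borel"
          using lim(2,3)[of \<omega>] elim(2) by auto
        show "(\<lambda>t. measure (\<mu> i (Suc t) \<omega>) (\<Union>F)) \<longlonglongrightarrow> measure (\<mu>_lim i \<omega>) (\<Union>F)"
          if "finite F" "F \<subseteq> \<B>" for F using elim(1) that by (simp add: \<F>_def)
      qed
      then show ?case unfolding weak_limit_def by (auto dest: LIMSEQ_imp_Suc)
    qed
    have "AE \<omega> in M. \<forall>F\<in>\<F>. measure (\<mu>_lim i \<omega>) (\<Union>F) = measure (\<mu>_all \<omega>) (\<Union>F)"
    proof (subst AE_ball_countable[OF \<F>], intro ballI)
      fix F assume F: "F \<in> \<F>"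
      have "AE \<omega> in M. cond_prob_of M (info_limit i) (state_event (\<Union>F)) \<omega> =
          cond_prob_of M signal_info (state_event (\<Union>F)) \<omega>"
        by (rule limit_posterior_eq_full_posterior[OF _ bayes _ i borel[OF F]])
          (use conn info in \<open>auto simp: agents_def\<close>)
      with lim(1)[OF borel[OF F]] all(1)[OF borel[OF F]]
      show "AE \<omega> in M. measure (\<mu>_lim i \<omega>) (\<Union>F) = measure (\<mu>_all \<omega>) (\<Union>F)"
        by eventually_elim (simp add: state_event_def agents_def)
    qed
    then show "AE \<omega> in M. \<mu>_lim i \<omega> = \<mu>_all \<omega>"
      using AE_space
    proof eventually_elim
      case (elim \<omega>)
      show ?case
      proof (rule prob_measure_eqI_finite_unions_of_basis[OF _ _ _ _ \<B>])
        show "measure (\<mu>_lim i \<omega>) (\<Union>F) = measure (\<mu>_all \<omega>) (\<Union>F)"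
          if "finite F" "F \<subseteq> \<B>" for F using elim(1) that by (simp add: \<F>_def)
      qed (use lim(2,3)[of \<omega>] all(2,3)[of \<omega>] elim(2) in auto)
    qed
  qed
qed

end
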